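(* Let $\omega\in(0,2\pi]$ and let $\Omega=\{(r\cos\varphi,r\sin\varphi)\in\mathbb{R}^2: 0<r<1,\ 0<\varphi<\omega\}$. Let $k\in\mathbb{N}_0$ and $m\in\mathbb{N}$, put $\nu_k=k\frac{\pi}{\omega}$, and let $u_{\nu_k,m}$ be the Laplace eigenfunction of the circular sector $\Omega$ given in polar coordinates by $$u_{\nu_k,m}(r,\varphi)=J_{\nu_k}(\mu_{\nu_k,m}\,r)\cos(\nu_k\varphi),$$ where $\mu_{\nu_k,m}$ is the $m$-th positive root of the Bessel function $J_{\nu_k}$. Then $$u_{\nu_k,m}\in H^s(\Omega)\quad\text{for all } s\ge 0 \text{ with } s<\nu_k+1 .$$
   Context: $\mathbb{N}=\{1,2,\dots\}$ and $\mathbb{N}_0=\mathbb{N}\cup\{0\}$. $J_\nu$ denotes the Bessel function of the first kind of order $\nu\ge 0$, $J_\nu(z)=\sum_{j=0}^\infty \frac{(-1)^j}{j!\,\Gamma(\nu+j+1)}\left(\frac z2\right)^{2j+\nu}$ for $z\geq 0$, and its positive roots are numbered in increasing order, $\mu_{\nu,1}<\mu_{\nu,2}<\dots$. The functions $u_{\nu_k,m}$ are the eigenfunctions of $-\Delta$ on $\Omega$ with homogeneous Dirichlet conditions on the circular arc $\{r=1\}$ and homogeneous Neumann conditions on the two straight legs $\varphi\in\{0,\omega\}$, with eigenvalue $\mu_{\nu_k,m}^2$ (normalization constant equal to $1$). For $s\in\mathbb{N}_0$, $H^s(\Omega)$ is the classical $L^2$-based Sobolev space, with $H^0(\Omega)=L^2(\Omega)$;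 for $s\ge 0$ with $s\notin\mathbb{N}_0$, $H^s(\Omega)$ denotes the Sobolev–Slobodeckij space.
   Formalization: For ω=2π, k odd and fractional part of s at least 1/2, the claim with the Euclidean Slobodeckij seminorm is false (u or its derivatives jump across the slit); there membership is proved only with the inner path distance of Ω in the seminorm, which is proved in all cases. *)

theory Defs
  imports "HOL-Analysis.Analysis"
begin

text \<open>The case \<open>\<nu> = 0\<close> is split off because Isabelle has \<open>0 powr 0 = 0\<close>, whereas
  \<open>J\<^sub>0(0) = 1\<close>. Only arguments \<open>z \<ge> 0\<close> are meaningful.\<close>

definition bessel_J :: "real \<Rightarrow> real \<Rightarrow> real" where
  "bessel_J \<nu> z = (\<Sum>j. (-1) ^ j / (fact j * Gamma (\<nu> + real j + 1)) *
     ((z / 2) ^ (2 * j) * (if \<nu> = 0 then 1 else (z / 2) powr \<nu>)))"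

text \<open>For \<open>m \<ge> 1\<close> the cardinality condition also forces the counted set to be finite.\<close>

definition is_bessel_root :: "real \<Rightarrow> nat \<Rightarrow> real \<Rightarrow> bool" where
  "is_bessel_root \<nu> m \<mu> \<longleftrightarrow>
     0 < \<mu> \<and> bessel_J \<nu> \<mu> = 0 \<and> card {x. 0 < x \<and> x \<le> \<mu> \<and> bessel_J \<nu> x = 0} = m"

definition polar :: "real \<Rightarrow> real \<Rightarrow> real ^ 2" where
  "polar r \<phi> = vector [r * cos \<phi>, r * sin \<phi>]"

definition sector :: "real \<Rightarrow> (real ^ 2) set" where
  "sector \<omega> = {polar r \<phi> | r \<phi>. 0 < r \<and> r < 1 \<and> 0 < \<phi> \<and> \<phi> < \<omega>}"

text \<open>A multi-index of order \<open>n\<close> is represented by a list of \<open>n\<close> basis vectors, the directions of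
  differentiation. For smooth functions the order of the list is irrelevant.\<close>

definition partial_deriv :: "'a::euclidean_space \<Rightarrow> ('a \<Rightarrow> real) \<Rightarrow> 'a \<Rightarrow> real" where
  "partial_deriv b f = (\<lambda>x. frechet_derivative f (at x) b)"

definition partials :: "'a::euclidean_space list \<Rightarrow> ('a \<Rightarrow> real) \<Rightarrow> 'a \<Rightarrow> real" where
  "partials bs f = foldr partial_deriv bs f"

definition smooth :: "('a::euclidean_space \<Rightarrow> real) \<Rightarrow> bool" where
  "smooth f \<longleftrightarrow> (\<forall>bs. set bs \<subseteq> Basis \<longrightarrow> partials bs f differentiable_on UNIV)"

definition test_function :: "'a::euclidean_space set \<Rightarrow> ('a \<Rightarrow> real) \<Rightarrow> bool" where
  "test_function \<Omega> \<psi> \<longleftrightarrow>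
     smooth \<psi> \<and> compact (closure {x. \<psi> x \<noteq> 0}) \<and> closure {x. \<psi> x \<noteq> 0} \<subseteq> \<Omega>"

definition L2 :: "'a::euclidean_space set \<Rightarrow> ('a \<Rightarrow> real) set" where
  "L2 \<Omega> = {f. f \<in> borel_measurable (lebesgue_on \<Omega>) \<and> integrable (lebesgue_on \<Omega>) (\<lambda>x. (f x)\<^sup>2)}"

text \<open>Only used for \<open>u\<close> and \<open>g\<close> in \<open>L2 \<Omega>\<close>, so that both integrals exist.\<close>

definition weak_deriv ::
  "'a::euclidean_space set \<Rightarrow> 'a list \<Rightarrow> ('a \<Rightarrow> real) \<Rightarrow> ('a \<Rightarrow> real) \<Rightarrow> bool" where
  "weak_deriv \<Omega> bs u g \<longleftrightarrow> (\<forall>\<psi>. test_function \<Omega> \<psi> \<longrightarrow>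
     integral\<^sup>L (lebesgue_on \<Omega>) (\<lambda>x. u x * partials bs \<psi> x) =
     (-1) ^ length bs * integral\<^sup>L (lebesgue_on \<Omega>) (\<lambda>x. g x * \<psi> x))"

definition sobolev :: "'a::euclidean_space set \<Rightarrow> nat \<Rightarrow> ('a \<Rightarrow> real) set" where
  "sobolev \<Omega> n = {u \<in> L2 \<Omega>. \<forall>bs. set bs \<subseteq> Basis \<and> length bs \<le> n \<longrightarrow>
     (\<exists>g \<in> L2 \<Omega>. weak_deriv \<Omega> bs u g)}"

text \<open>The square of the Slobodeckij seminorm of order \<open>\<sigma> \<in> (0,1)\<close>, with respect to a distance
  function \<open>d\<close> on \<open>\<Omega>\<close>; the usual one is \<open>d = dist\<close>.\<close>

definition slobodeckij_energy ::
  "('a::euclidean_space \<Rightarrow> 'a \<Rightarrow> real) \<Rightarrow> 'a set \<Rightarrow> real \<Rightarrow> ('a \<Rightarrow> real) \<Rightarrow> ennreal" where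
  "slobodeckij_energy d \<Omega> \<sigma> g =
     (\<integral>\<^sup>+ x. (\<integral>\<^sup>+ y. ennreal ((g x - g y)\<^sup>2 / d x y powr (real DIM('a) + 2 * \<sigma>))
        \<partial>lebesgue_on \<Omega>) \<partial>lebesgue_on \<Omega>)"

definition sobolev_slobodeckij ::
  "('a::euclidean_space \<Rightarrow> 'a \<Rightarrow> real) \<Rightarrow> 'a set \<Rightarrow> real \<Rightarrow> ('a \<Rightarrow> real) set" where
  "sobolev_slobodeckij d \<Omega> s = {u \<in> sobolev \<Omega> (nat \<lfloor>s\<rfloor>). frac s \<noteq> 0 \<longrightarrow>
     (\<forall>bs. set bs \<subseteq> Basis \<and> length bs = nat \<lfloor>s\<rfloor> \<longrightarrow>
        (\<exists>g \<in> L2 \<Omega>. weak_deriv \<Omega> bs u g \<and> slobodeckij_energy d \<Omega> (frac s) g < \<infinity>))}"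

text \<open>The length metric of a connected open set \<open>\<Omega>\<close>: the infimum of the lengths of the polygonal
  paths from \<open>x\<close> to \<open>y\<close> inside \<open>\<Omega>\<close>.

  It is needed for the slit disc \<open>\<omega> = 2\<pi>\<close>. There the Euclidean distance does not see the slit:
  up to a null set the slit disc is the full disc, so the Euclidean Slobodeckij space of order
  \<open>\<sigma> \<in> [1/2,1)\<close> contains no function with a jump across the slit such as
  \<open>J(\<mu> r) cos (\<phi>/2)\<close> with \<open>J\<close> of order \<open>1/2\<close>, and it does not even contain \<open>H\<^sup>1\<close>. For every
  sector with \<open>\<omega> < 2\<pi>\<close> the two distances are equivalent and give the same spaces.\<close>

definition inner_dist :: "'a::euclidean_space set \<Rightarrow> 'a \<Rightarrow> 'a \<Rightarrow> real" where
  "inner_dist \<Omega> x y = Inf {\<Sum>i<n. dist (p i) (p (Suc i)) | p n.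
     p 0 = x \<and> p n = y \<and> (\<forall>i<n. closed_segment (p i) (p (Suc i)) \<subseteq> \<Omega>)}"

end

theory Submission
  imports Defs
begin

text \<open>On the sector, \<open>u = Re (z powr \<nu>) * P (|z|\<^sup>2)\<close> with an entire power series \<open>P\<close>, so the derivatives of
  order \<open>n\<close> of \<open>u\<close> are \<open>O(|z| powr (\<nu> - n))\<close>. For \<open>n \<le> s < \<nu> + 1\<close> they are square integrable in the plane, and
  integration by parts shows that they are weak derivatives.

  Let \<open>g\<close> be a derivative of order \<open>n = \<lfloor>s\<rfloor>\<close>, \<open>\<sigma> = s - n\<close> and \<open>b = min (\<nu> - n) 0\<close>. The bounds on \<open>g\<close> and on its
  gradient interpolate to \<open>|g x - g y| \<le> C (d x y powr \<theta>) (|x| powr (b - \<theta>) + |y| powr (b - \<theta>))\<close>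
  for every \<open>\<theta>\<close> in \<open>[0,1]\<close>, provided that nearby points are joined by a short path on which \<open>g\<close> is smooth. With
  \<open>\<sigma> < \<theta> < b + 1\<close> the double integral of the seminorm then splits into two convergent integrals, of
  \<open>|x - y| powr (2 * \<theta> - 2 - 2 * \<sigma>)\<close> and of \<open>|x| powr (2 * b - 2 * \<theta>)\<close>.

  Short paths always exist for the inner distance. For the Euclidean distance a segment can leave the
  domain of \<open>g\<close>; if \<open>\<omega> < 2 * pi\<close> this forces \<open>|x - y|\<close> to be comparable with \<open>|x|\<close> and \<open>|y|\<close>; if \<open>\<omega> = 2 * pi\<close> and
  \<open>k\<close> is even, then \<open>g\<close> extends smoothly across the slit; otherwise \<open>g\<close> jumps there, which is harmless for \<open>\<sigma> < 1/2\<close>.\<close>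

section \<open>Singular kernels and the Slobodeckij energy\<close>

text \<open>The value \<open>\<infinity>\<close> at \<open>0\<close>, in place of the junk value \<open>0 powr (-\<alpha>) = 0\<close>, makes the pointwise bounds
  below hold on the coordinate hyperplanes too.\<close>

definition kern :: "real \<Rightarrow> real \<Rightarrow> ennreal" where
  "kern \<alpha> t = (if t = 0 then \<infinity> else ennreal (\<bar>t\<bar> powr (-\<alpha>)))"

text \<open>A product of one-dimensional kernels replaces a power of the norm because its integral
  over a cube factorizes. The exponents may differ between directions, which the weight for a slit
  requires.\<close>

definition box_kern :: "('a \<Rightarrow> real) \<Rightarrow> 'a::euclidean_space \<Rightarrow> ennreal" where
  "box_kern e x = (\<Prod>b\<in>Basis. kern (e b) (x \<bullet> b))"

lemma kern_measurable [measurable]: "kern \<alpha> \<in> borel_measurable borel"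
  unfolding kern_def[abs_def] by measurable

lemma box_kern_measurable [measurable]: "box_kern e \<in> borel_measurable borel"
  unfolding box_kern_def[abs_def] by measurable

lemma kern_minus: "kern \<alpha> (- t) = kern \<alpha> t"
  by (simp add: kern_def)

lemma kern_integral_finite:
  assumes "\<alpha> < 1"
  shows "(\<integral>\<^sup>+t. kern \<alpha> t * indicator {-2..2} t \<partial>lborel) < \<infinity>"
proof -
  define J where "J = (\<integral>\<^sup>+t. kern \<alpha> t * indicator {0..2} t \<partial>lborel)"
  \<comment> \<open>The two integrands differ only on the null set \<open>{0}\<close>, and the
    second is a power with exponent above -1.\<close>
  have "J = (\<integral>\<^sup>+t. ennreal (t powr (-\<alpha>)) * indicator {0..2} t \<partial>lborel)"
    unfolding J_def
    by (intro nn_integral_cong_AE, use AE_lborel_singleton[of "0::real"] in eventually_elim)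
       (auto simp: kern_def indicator_def)
  also have "\<dots> = ennreal (2 powr (-\<alpha>+1) / (-\<alpha>+1))"
    using assms by (intro nn_integral_has_integral_lebesgue' has_integral_powr_from_0) auto
  finally have J: "J < \<infinity>" by simp
  have "J = (\<integral>\<^sup>+t. kern \<alpha> t * indicator {-2..0} t \<partial>lborel)"
    unfolding J_def
    by (subst nn_integral_real_affine[where c = "-1" and t = 0])
       (auto intro!: nn_integral_cong simp: kern_minus indicator_def)
  then have "(\<integral>\<^sup>+t. kern \<alpha> t * indicator {0..2} t + kern \<alpha> t * indicator {-2..0} t \<partial>lborel) = J + J"
    by (subst nn_integral_add) (auto simp: J_def)
  moreover have "(\<integral>\<^sup>+t. kern \<alpha> t * indicator {-2..2} t \<partial>lborel) \<le>
    (\<integral>\<^sup>+t. kern \<alpha> t * indicator {0..2} t + kern \<alpha> t * indicator {-2..0} t \<partial>lborel)"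
    by (intro nn_integral_mono) (auto simp: indicator_def)
  ultimately show ?thesis using J by (auto intro: order_le_less_trans)
qed

text \<open>The ball is enlarged to the cube with sides \<open>{-1..1}\<close>, where the integral
  is a product of one-dimensional ones. A shift by a coordinate of modulus at most 1 stays within
  \<open>{-2..2}\<close>, so the bound is uniform in \<open>x\<close>; this lets the inner integral
  of the seminorm be replaced by a constant.\<close>

lemma box_kern_shift_integral:
  assumes "\<And>b. b \<in> Basis \<Longrightarrow> e b < 1"
  obtains K where "K < \<infinity>"
    "\<And>x::'a::euclidean_space. norm x \<le> 1 \<Longrightarrow>
      (\<integral>\<^sup>+y. box_kern e (x - y) * indicator (ball 0 1) y \<partial>lborel) \<le> K"
proof
  define K where "K = (\<Prod>b\<in>(Basis::'a set). \<integral>\<^sup>+t. kern (e b) t * indicator {-2..2} t \<partial>lborel)"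
  show "K < \<infinity>"
    unfolding K_def using kern_integral_finite[OF assms]
    by (auto simp: ennreal_prod_eq_top less_top[symmetric])
  fix x :: 'a assume x: "norm x \<le> 1"
  have "(\<integral>\<^sup>+y. box_kern e (x - y) * indicator (ball 0 1) y \<partial>lborel)
    \<le> (\<integral>\<^sup>+y. (\<Prod>b\<in>Basis. kern (e b) (x \<bullet> b - y \<bullet> b) * indicator {-1..1} (y \<bullet> b)) \<partial>lborel)"
  proof (intro nn_integral_mono)
    fix y :: 'a
    show "box_kern e (x - y) * indicator (ball 0 1) y \<le>
      (\<Prod>b\<in>Basis. kern (e b) (x \<bullet> b - y \<bullet> b) * indicator {-1..1} (y \<bullet> b))"
    proof (cases "y \<in> ball 0 1")
      case True
      then have "\<And>b. b \<in> Basis \<Longrightarrow> y \<bullet> b \<in> {-1..1}"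
        using Basis_le_norm[of _ y] by (force simp: abs_le_iff)
      then show ?thesis using True by (simp add: box_kern_def inner_diff_left)
    qed auto
  qed
  also have "\<dots> = (\<Prod>b\<in>Basis. \<integral>\<^sup>+t. kern (e b) (x \<bullet> b - t) * indicator {-1..1} t \<partial>lborel)"
    by (rule nn_integral_lborel_prod) auto
  also have "\<dots> \<le> K"
    unfolding K_def
  proof (intro prod_mono_ennreal)
    fix b :: 'a assume b: "b \<in> Basis"
    have xb: "\<bar>x \<bullet> b\<bar> \<le> 1" using Basis_le_norm[OF b, of x] x by simp
    have "(\<integral>\<^sup>+t. kern (e b) t * indicator {-2..2} t \<partial>lborel) =
      (\<integral>\<^sup>+t. kern (e b) (x \<bullet> b - t) * indicator {-2..2} (x \<bullet> b - t) \<partial>lborel)"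
      by (subst nn_integral_real_affine[where c = "-1" and t = "x \<bullet> b"]) auto
    also have "\<dots> \<ge> (\<integral>\<^sup>+t. kern (e b) (x \<bullet> b - t) * indicator {-1..1} t \<partial>lborel)"
      using xb by (intro nn_integral_mono) (auto simp: indicator_def)
    finally show "(\<integral>\<^sup>+t. kern (e b) (x \<bullet> b - t) * indicator {-1..1} t \<partial>lborel) \<le>
      (\<integral>\<^sup>+t. kern (e b) t * indicator {-2..2} t \<partial>lborel)" .
  qed
  finally show "(\<integral>\<^sup>+y. box_kern e (x - y) * indicator (ball 0 1) y \<partial>lborel) \<le> K" .
qed

lemma box_kern_minus: "box_kern e (- x) = box_kern e x"
  by (simp add: box_kern_def kern_minus)

lemma box_kern_integral_finite:
  assumes "\<And>b. b \<in> Basis \<Longrightarrow> e b < 1"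
  shows "(\<integral>\<^sup>+y. box_kern e (y::'a::euclidean_space) * indicator (ball 0 1) y \<partial>lborel) < \<infinity>"
proof -
  obtain K where "K < \<infinity>" "\<And>x::'a::euclidean_space. norm x \<le> 1 \<Longrightarrow>
      (\<integral>\<^sup>+y. box_kern e (x - y) * indicator (ball 0 1) y \<partial>lborel) \<le> K"
    using box_kern_shift_integral[of e] assms by blast
  from this(1) this(2)[of 0] show ?thesis by (simp add: box_kern_minus order_le_less_trans)
qed

lemma kern_ge:
  assumes "\<bar>t\<bar> \<le> N" "0 \<le> \<alpha>"
  shows "ennreal (N powr (-\<alpha>)) \<le> kern \<alpha> t"
  using assms by (auto simp: kern_def intro!: ennreal_leI powr_mono2')

text \<open>The power of the norm is distributed over the coordinates. Each coordinate is at most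
  the norm in modulus and the exponents \<open>- e b\<close> are nonpositive, so every factor grows
  when the norm is replaced by the coordinate.\<close>

lemma norm_powr_le_box_kern:
  fixes x :: "'a::euclidean_space"
  assumes "x \<noteq> 0" "\<And>b. b \<in> Basis \<Longrightarrow> 0 \<le> e b"
  shows "ennreal (norm x powr (- (\<Sum>b\<in>Basis. e b))) \<le> box_kern e x"
proof -
  have "norm x powr (- (\<Sum>b\<in>Basis. e b)) = (\<Prod>b\<in>(Basis::'a set). norm x powr (- e b))"
    using assms by (simp add: powr_sum sum_negf[symmetric])
  then have "ennreal (norm x powr (- (\<Sum>b\<in>Basis. e b))) = (\<Prod>b\<in>(Basis::'a set). ennreal (norm x powr (- e b)))"
    by (simp add: prod_ennreal)
  also have "\<dots> \<le> box_kern e x"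
    unfolding box_kern_def by (intro prod_mono_ennreal kern_ge Basis_le_norm assms) auto
  finally show ?thesis .
qed

text \<open>The term with \<open>W x\<close> is integrated first in \<open>y\<close>, where the
  kernel contributes at most \<open>K\<close>, and then in \<open>x\<close>. The term with
  \<open>W y\<close> reduces to it by Tonelli and the symmetry of \<open>P\<close>. Measurability is
  demanded of the majorant alone, since monotonicity of \<open>nn_integral\<close> covers arbitrary
  \<open>g\<close> and \<open>d\<close>.\<close>

lemma slobodeckij_energy_finite:
  fixes \<Omega> :: "'a::euclidean_space set"
  assumes \<Omega>: "\<Omega> \<in> sets borel" "\<Omega> \<subseteq> ball 0 1"
    and e: "\<And>b. b \<in> Basis \<Longrightarrow> e b < 1"
    and W [measurable]: "W \<in> borel_measurable borel"
    and WI: "(\<integral>\<^sup>+x. W x * indicator (ball 0 1) x \<partial>lborel) < \<infinity>"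
    and bound: "\<And>x y. x \<in> \<Omega> \<Longrightarrow> y \<in> \<Omega> \<Longrightarrow>
      ennreal ((g x - g y)\<^sup>2 / d x y powr (real DIM('a) + 2 * \<sigma>)) \<le>
      ennreal C * ((W x + W y) * box_kern e (x - y))"
  shows "slobodeckij_energy d \<Omega> \<sigma> g < \<infinity>"
proof -
  define B where "B = ball (0::'a) 1"
  have [measurable]: "B \<in> sets borel" by (simp add: B_def)
  obtain K where K: "K < \<infinity>" "\<And>x::'a. norm x \<le> 1 \<Longrightarrow>
      (\<integral>\<^sup>+y. box_kern e (x - y) * indicator B y \<partial>lborel) \<le> K"
    using box_kern_shift_integral[of e] e unfolding B_def by blast
  define J where "J = (\<integral>\<^sup>+x. W x * indicator B x \<partial>lborel)"
  define P where "P = (\<lambda>x y. box_kern e (x - y) * indicator B x * indicator B y)"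
  have [measurable]: "(\<lambda>(x, y). P x y) \<in> borel_measurable (lborel \<Otimes>\<^sub>M lborel)"
    unfolding P_def by measurable
  have P_sym: "P x y = P y x" for x y
    unfolding P_def using box_kern_minus[of e "x - y"] by (simp add: mult_ac)
  \<comment> \<open>Passing from the completed measure to \<open>lborel\<close> makes Tonelli
    available for the Borel majorant.\<close>
  have on: "(\<integral>\<^sup>+x. f x \<partial>lebesgue_on \<Omega>) = (\<integral>\<^sup>+x. f x * indicator \<Omega> x \<partial>lborel)" for f :: "'a \<Rightarrow> ennreal"
    using \<Omega>(1) by (simp add: nn_integral_restrict_space nn_integral_completion)
  have A: "(\<integral>\<^sup>+x. \<integral>\<^sup>+y. W x * P x y \<partial>lborel \<partial>lborel) \<le> J * K"
  proof -
    have "(\<integral>\<^sup>+x. \<integral>\<^sup>+y. W x * P x y \<partial>lborel \<partial>lborel) \<le> (\<integral>\<^sup>+x. W x * indicator B x * K \<partial>lborel)"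
    proof (intro nn_integral_mono)
      fix x :: 'a
      have "(\<integral>\<^sup>+y. W x * P x y \<partial>lborel) =
        (\<integral>\<^sup>+y. W x * indicator B x * (box_kern e (x - y) * indicator B y) \<partial>lborel)"
        by (simp add: P_def mult_ac)
      also have "\<dots> = W x * indicator B x * (\<integral>\<^sup>+y. box_kern e (x - y) * indicator B y \<partial>lborel)"
        by (rule nn_integral_cmult) auto
      also have "\<dots> \<le> W x * indicator B x * K"
        using K(2)[of x] by (cases "x \<in> B") (auto simp: B_def intro: mult_left_mono)
      finally show "(\<integral>\<^sup>+y. W x * P x y \<partial>lborel) \<le> W x * indicator B x * K" .
    qed
    also have "\<dots> = J * K" unfolding J_def by (rule nn_integral_multc) auto
    finally show ?thesis .
  qed
  have B: "(\<integral>\<^sup>+x. \<integral>\<^sup>+y. W y * P x y \<partial>lborel \<partial>lborel) = (\<integral>\<^sup>+x. \<integral>\<^sup>+y. W x * P x y \<partial>lborel \<partial>lborel)"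
    by (subst lborel_pair.Fubini') (auto simp: P_sym)
  have "slobodeckij_energy d \<Omega> \<sigma> g =
    (\<integral>\<^sup>+x. (\<integral>\<^sup>+y. ennreal ((g x - g y)\<^sup>2 / d x y powr (real DIM('a) + 2 * \<sigma>)) * indicator \<Omega> y \<partial>lborel)
      * indicator \<Omega> x \<partial>lborel)"
    unfolding slobodeckij_energy_def on ..
  also have "\<dots> \<le> (\<integral>\<^sup>+x. \<integral>\<^sup>+y. ennreal C * (W x * P x y + W y * P x y) \<partial>lborel \<partial>lborel)"
  proof (intro nn_integral_mono)
    fix x :: 'a
    show "(\<integral>\<^sup>+y. ennreal ((g x - g y)\<^sup>2 / d x y powr (real DIM('a) + 2 * \<sigma>)) * indicator \<Omega> y \<partial>lborel)
      * indicator \<Omega> x \<le> (\<integral>\<^sup>+y. ennreal C * (W x * P x y + W y * P x y) \<partial>lborel)"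
    proof (cases "x \<in> \<Omega>")
      case True
      have "ennreal ((g x - g y)\<^sup>2 / d x y powr (real DIM('a) + 2 * \<sigma>)) * indicator \<Omega> y
        \<le> ennreal C * (W x * P x y + W y * P x y)" for y
        using bound[OF True, of y] True \<Omega>(2)
        by (cases "y \<in> \<Omega>") (auto simp: P_def B_def distrib_right subset_iff)
      then show ?thesis using True by (auto intro: nn_integral_mono)
    qed auto
  qed
  also have "\<dots> = (\<integral>\<^sup>+x. ennreal C * ((\<integral>\<^sup>+y. W x * P x y \<partial>lborel) + (\<integral>\<^sup>+y. W y * P x y \<partial>lborel)) \<partial>lborel)"
    by (intro nn_integral_cong) (simp add: nn_integral_cmult nn_integral_add)
  also have "\<dots> = ennreal C * ((\<integral>\<^sup>+x. \<integral>\<^sup>+y. W x * P x y \<partial>lborel \<partial>lborel) + (\<integral>\<^sup>+x. \<integral>\<^sup>+y. W y * P x y \<partial>lborel \<partial>lborel))"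
    by (simp add: nn_integral_cmult nn_integral_add)
  also have "\<dots> \<le> ennreal C * (J * K + J * K)"
    unfolding B by (intro mult_left_mono add_mono A) auto
  also have "\<dots> < \<infinity>"
    using K(1) WI unfolding B_def[symmetric] J_def[symmetric] by (simp add: ennreal_mult_less_top)
  finally show ?thesis .
qed

section \<open>Weak derivatives of smooth functions\<close>

lemma integrable_compact_support:
  fixes h :: "'a::euclidean_space \<Rightarrow> real"
  assumes "continuous_on UNIV h" "compact K" "\<And>x. x \<notin> K \<Longrightarrow> h x = 0"
  shows "integrable lborel h"
proof -
  have "integrable lborel (\<lambda>x. indicator K x *\<^sub>R h x)"
    using assms by (intro borel_integrable_compact) (auto intro: continuous_on_subset)
  also have "(\<lambda>x. indicator K x *\<^sub>R h x) = h"
    using assms(3) by (auto simp: indicator_def fun_eq_iff)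
  finally show ?thesis .
qed

text \<open>The difference quotients of \<open>F\<close> have integral \<open>0\<close> by translation invariance and converge
  dominatedly to the partial derivative.\<close>

lemma integral_directional_deriv_eq_0:
  fixes F :: "'a::euclidean_space \<Rightarrow> real"
  assumes F: "\<And>x. (F has_derivative F' x) (at x)"
    and cont: "continuous_on UNIV (\<lambda>x. F' x b)"
    and K: "compact K" "\<And>x. x \<notin> K \<Longrightarrow> F x = 0" "\<And>x. x \<notin> K \<Longrightarrow> F' x b = 0"
  shows "integral\<^sup>L lborel (\<lambda>x. F' x b) = 0"
proof -
  define q where "q n x = (F (inverse (real (Suc n)) *\<^sub>R b + x) - F x) / inverse (real (Suc n))" for n x
  have cF: "continuous_on UNIV F"
    using F by (intro continuous_at_imp_continuous_on) (auto intro: has_derivative_continuous)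
  then have [measurable]: "F \<in> borel_measurable borel"
    by (rule borel_measurable_continuous_onI)
  have [measurable]: "(\<lambda>x. F' x b) \<in> borel_measurable borel"
    using cont by (rule borel_measurable_continuous_onI)
  have iF: "integrable lborel F"
    by (rule integrable_compact_support[OF cF K(1,2)])
  have shift: "integrable lborel (\<lambda>x. F (c + x))" "integral\<^sup>L lborel (\<lambda>x. F (c + x)) = integral\<^sup>L lborel F" for c
  proof -
    have "integrable (distr lborel borel ((+) c)) F" using iF by (simp add: lborel_distr_plus)
    then show "integrable lborel (\<lambda>x. F (c + x))" by (subst (asm) integrable_distr_eq) auto
    have "integral\<^sup>L (distr lborel borel ((+) c)) F = integral\<^sup>L lborel (\<lambda>x. F (c + x))"
      by (rule integral_distr) auto
    then show "integral\<^sup>L lborel (\<lambda>x. F (c + x)) = integral\<^sup>L lborel F" by (simp add: lborel_distr_plus)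
  qed
  have q0: "integral\<^sup>L lborel (q n) = 0" for n
    unfolding q_def using iF shift by simp
  have "bounded ((\<lambda>x. F' x b) ` K)"
    using K(1) cont by (intro compact_imp_bounded compact_continuous_image) (auto intro: continuous_on_subset)
  then obtain M where M: "\<And>x. x \<in> K \<Longrightarrow> \<bar>F' x b\<bar> \<le> M" "M > 0"
    unfolding bounded_pos by auto
  have M': "\<bar>F' x b\<bar> \<le> M" for x using M K(3)[of x] by (cases "x \<in> K") auto
  obtain R where R: "\<And>x. x \<in> K \<Longrightarrow> norm x \<le> R"
    using compact_imp_bounded[OF K(1)] unfolding bounded_iff by blast
  \<comment> \<open>The steps of the quotients are at most 1, so both points of a quotient lie
    outside \<open>K\<close> once \<open>norm x > R + norm b\<close>. Elsewhere the mean value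
    theorem bounds the quotient by \<open>M\<close>.\<close>
  define w where "w x = M * indicator (cball 0 (R + norm b)) x" for x :: 'a
  have "compact (cball 0 (R + norm b) :: 'a set)" by simp
  then have w: "integrable lborel w"
    unfolding w_def using borel_integrable_compact[of "cball 0 (R + norm b) :: 'a set" "\<lambda>_. 1::real"]
    by (intro integrable_mult_right) auto
  have dom: "norm (q n x) \<le> w x" for n x
  proof -
    let ?h = "inverse (real (Suc n))"
    have h: "0 < ?h" "?h \<le> 1" by (auto simp: inverse_le_1_iff)
    have "\<exists>z>0. z < ?h \<and> F (x + ?h *\<^sub>R b) - F (x + 0 *\<^sub>R b) = (?h - 0) * F' (x + z *\<^sub>R b) b"
    proof (rule MVT2)
      fix t :: real
      have "((\<lambda>t. F (x + t *\<^sub>R b)) has_derivative (\<lambda>s. F' (x + t *\<^sub>R b) (s *\<^sub>R b))) (at t)"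
        by (rule has_derivative_compose[OF _ F]) (auto intro!: derivative_eq_intros)
      moreover have "F' (x + t *\<^sub>R b) (s *\<^sub>R b) = F' (x + t *\<^sub>R b) b * s" for s
        using linear_scale[OF has_derivative_linear[OF F]] by simp
      ultimately show "((\<lambda>t. F (x + t *\<^sub>R b)) has_real_derivative F' (x + t *\<^sub>R b) b) (at t)"
        by (simp add: has_field_derivative_def)
    qed (use h in auto)
    then obtain z where "F (?h *\<^sub>R b + x) - F x = ?h * F' (x + z *\<^sub>R b) b"
      by (auto simp: add.commute)
    then have "q n x = F' (x + z *\<^sub>R b) b" using h by (simp add: q_def)
    then have qM: "\<bar>q n x\<bar> \<le> M" using M' by simp
    have "q n x = 0" if "x \<notin> cball 0 (R + norm b)"
    proof -
      have n: "norm x > R + norm b" using that by simp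
      have "norm (?h *\<^sub>R b) \<le> 1 * norm b"
        unfolding norm_scaleR using h by (intro mult_right_mono) auto
      then have "norm (?h *\<^sub>R b + x) > R"
        using norm_triangle_ineq2[of x "- (?h *\<^sub>R b)"] n by (simp add: add.commute)
      moreover have "norm x > R" using n norm_ge_zero[of b] by linarith
      ultimately have "?h *\<^sub>R b + x \<notin> K" "x \<notin> K"
        using R[of x] R[of "?h *\<^sub>R b + x"] by linarith+
      then have "F (?h *\<^sub>R b + x) = 0" "F x = 0" using K(2) by blast+
      then show ?thesis by (simp add: q_def)
    qed
    then show ?thesis using qM by (auto simp: w_def indicator_def)
  qed
  have lim: "(\<lambda>n. q n x) \<longlonglongrightarrow> F' x b" for x
  proof -
    have "((\<lambda>t. F (x + t *\<^sub>R b)) has_derivative (\<lambda>s. F' x (s *\<^sub>R b))) (at 0)"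
      by (rule has_derivative_compose[where f = "\<lambda>t. x + t *\<^sub>R b" and g = F and x = 0])
         (use F in \<open>auto intro!: derivative_eq_intros\<close>)
    moreover have "F' x (s *\<^sub>R b) = F' x b * s" for s
      using linear_scale[OF has_derivative_linear[OF F]] by simp
    ultimately have "((\<lambda>t. F (x + t *\<^sub>R b)) has_real_derivative F' x b) (at 0)"
      by (simp add: has_field_derivative_def)
    then have "((\<lambda>h. (F (x + h *\<^sub>R b) - F x) / h) \<longlongrightarrow> F' x b) (at 0)"
      by (simp add: DERIV_def)
    moreover have "filterlim (\<lambda>n. inverse (real (Suc n))) (at 0) sequentially"
      using LIMSEQ_inverse_real_of_nat by (auto simp: filterlim_at)
    ultimately have "(\<lambda>n. (F (x + inverse (real (Suc n)) *\<^sub>R b) - F x) / inverse (real (Suc n))) \<longlonglongrightarrow> F' x b"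
      by (rule filterlim_compose)
    then show ?thesis by (simp add: q_def add.commute)
  qed
  have "(\<lambda>n. integral\<^sup>L lborel (q n)) \<longlonglongrightarrow> integral\<^sup>L lborel (\<lambda>x. F' x b)"
    by (rule integral_dominated_convergence[where w = w]) (use w dom lim in \<open>auto simp: q_def[abs_def]\<close>)
  then show ?thesis by (simp add: q0 LIMSEQ_const_iff)
qed

lemma partial_deriv_outside_support:
  assumes "x \<notin> closure {x. f x \<noteq> 0}"
  shows "partial_deriv b f x = 0"
proof -
  have "(f has_derivative (\<lambda>_. 0)) (at x)"
    by (rule has_derivative_transform_within_open[where f = "\<lambda>_. 0" and s = "- closure {x. f x \<noteq> 0}"])
       (use assms closure_subset[of "{x. f x \<noteq> 0}"] in \<open>auto\<close>)
  then have "frechet_derivative f (at x) = (\<lambda>_. 0)"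
    using frechet_derivative_at by metis
  then show ?thesis by (simp add: partial_deriv_def)
qed

lemma support_partials: "closure {x. partials bs f x \<noteq> 0} \<subseteq> closure {x. f x \<noteq> 0}"
proof (induction bs)
  case (Cons b bs)
  have "{x. partials (b # bs) f x \<noteq> 0} \<subseteq> closure {x. partials bs f x \<noteq> 0}"
    using partial_deriv_outside_support[of _ "partials bs f" b] by (auto simp: partials_def)
  then have "closure {x. partials (b # bs) f x \<noteq> 0} \<subseteq> closure {x. partials bs f x \<noteq> 0}"
    by (simp add: closure_minimal)
  then show ?case using Cons by blast
qed (simp add: partials_def)

lemma test_function_partials:
  assumes "test_function \<Omega> \<psi>" "set bs \<subseteq> Basis"
  shows "test_function \<Omega> (partials bs \<psi>)"
proof -
  have "partials cs (partials bs \<psi>) = partials (cs @ bs) \<psi>" for cs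
    by (simp add: partials_def)
  then have "smooth (partials bs \<psi>)"
    using assms unfolding test_function_def smooth_def by auto
  moreover have "compact (closure {x. partials bs \<psi> x \<noteq> 0})"
    using compact_Int_closed[of "closure {x. \<psi> x \<noteq> 0}" "closure {x. partials bs \<psi> x \<noteq> 0}"]
      assms support_partials[of bs \<psi>]
    by (simp add: test_function_def Int_absorb1)
  ultimately show ?thesis
    using assms support_partials[of bs \<psi>] unfolding test_function_def by blast
qed

text \<open>Integration by parts: the derivative of the product of \<open>f\<close> and
  \<open>\<psi>\<close> has integral 0. Since \<open>\<psi>\<close> vanishes outside a compact
  subset of \<Omega>, the product extends by zero to a differentiable function on the whole space,
  however \<open>f\<close> behaves near the boundary.\<close>

lemma weak_deriv_classical:
  fixes f :: "'a::euclidean_space \<Rightarrow> real"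
  assumes \<Omega>: "open \<Omega>"
    and f: "\<And>x. x \<in> \<Omega> \<Longrightarrow> (f has_derivative f' x) (at x)"
    and cont: "continuous_on \<Omega> (\<lambda>x. f' x b)"
    and \<psi>: "test_function \<Omega> \<psi>" and b: "b \<in> Basis"
  shows "integral\<^sup>L (lebesgue_on \<Omega>) (\<lambda>x. f x * partial_deriv b \<psi> x) =
    - integral\<^sup>L (lebesgue_on \<Omega>) (\<lambda>x. f' x b * \<psi> x)"
proof -
  define K where "K = closure {x. \<psi> x \<noteq> 0}"
  have K: "compact K" "K \<subseteq> \<Omega>" using \<psi> by (auto simp: test_function_def K_def)
  have \<psi>0: "\<psi> x = 0" "partial_deriv b \<psi> x = 0" if "x \<notin> K" for x
    using that closure_subset[of "{x. \<psi> x \<noteq> 0}"] partial_deriv_outside_support[of x \<psi> b]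
    by (auto simp: K_def)
  have sm: "smooth \<psi>" using \<psi> by (simp add: test_function_def)
  have d\<psi>: "\<psi> differentiable at x" for x
    using sm[unfolded smooth_def, rule_format, of "[]"] by (simp add: partials_def differentiable_on_def)
  then have D\<psi>: "(\<psi> has_derivative frechet_derivative \<psi> (at x)) (at x)" for x
    using frechet_derivative_works by blast
  have c\<psi>: "continuous_on UNIV \<psi>"
    using d\<psi> by (simp add: continuous_at_imp_continuous_on differentiable_imp_continuous_within)
  have c\<psi>': "continuous_on UNIV (partial_deriv b \<psi>)"
    using sm[unfolded smooth_def, rule_format, of "[b]"] b
    by (simp add: partials_def differentiable_imp_continuous_on)
  have cf: "continuous_on \<Omega> f"
    using f by (intro continuous_at_imp_continuous_on) (auto intro: has_derivative_continuous)
  \<comment> \<open>\<Omega> and \<open>- K\<close> are open and cover the space; the product is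
    continuous on the first and zero on the second.\<close>
  have glue: "continuous_on UNIV (\<lambda>x. h x * p x)"
    if "continuous_on \<Omega> h" "continuous_on UNIV p" "\<And>x. x \<notin> K \<Longrightarrow> p x = 0" for h p :: "'a \<Rightarrow> real"
  proof -
    have "continuous_on \<Omega> (\<lambda>x. h x * p x)"
      using that by (intro continuous_intros) (auto intro: continuous_on_subset)
    moreover have "continuous_on (- K) (\<lambda>x. h x * p x) \<longleftrightarrow> continuous_on (- K) (\<lambda>_. 0::real)"
      using that by (intro continuous_on_cong) auto
    ultimately have "continuous_on (\<Omega> \<union> - K) (\<lambda>x. h x * p x)"
      using \<Omega> K(1) by (intro continuous_on_open_Un) (auto simp: compact_imp_closed)
    also have "\<Omega> \<union> - K = UNIV" using K by auto
    finally show ?thesis .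
  qed
  have c1: "continuous_on UNIV (\<lambda>x. f x * partial_deriv b \<psi> x)"
    and c2: "continuous_on UNIV (\<lambda>x. f' x b * \<psi> x)"
    using glue cf c\<psi>' cont c\<psi> \<psi>0 by auto
  have i1: "integrable lborel (\<lambda>x. f x * partial_deriv b \<psi> x)"
    and i2: "integrable lborel (\<lambda>x. f' x b * \<psi> x)"
    using integrable_compact_support[OF c1 K(1)] integrable_compact_support[OF c2 K(1)] \<psi>0 by auto
  have on: "integral\<^sup>L (lebesgue_on \<Omega>) (\<lambda>x. h x * p x) = integral\<^sup>L lborel (\<lambda>x. h x * p x)"
    if "continuous_on UNIV (\<lambda>x. h x * p x)" "\<And>x. x \<notin> K \<Longrightarrow> p x = 0" for h p :: "'a \<Rightarrow> real"
  proof -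
    have "integral\<^sup>L (lebesgue_on \<Omega>) (\<lambda>x. h x * p x) = integral\<^sup>L lebesgue (\<lambda>x. indicator \<Omega> x *\<^sub>R (h x * p x))"
      using \<Omega> by (intro integral_restrict_space) auto
    also have "(\<lambda>x. indicator \<Omega> x *\<^sub>R (h x * p x)) = (\<lambda>x. h x * p x)"
      using that(2) K(2) by (auto simp: fun_eq_iff indicator_def)
    also have "integral\<^sup>L lebesgue \<dots> = integral\<^sup>L lborel \<dots>"
      using borel_measurable_continuous_onI[OF that(1)] by (intro integral_completion) auto
    finally show ?thesis .
  qed
  \<comment> \<open>Outside \<open>K\<close> the derivative is set to 0, since \<open>f'\<close> is
    a derivative of \<open>f\<close> only at points of \<Omega>.\<close>
  define F' where "F' x h = (if x \<in> K then f x * frechet_derivative \<psi> (at x) h + f' x h * \<psi> x else 0)" for x h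
  have F'b: "F' x b = f x * partial_deriv b \<psi> x + f' x b * \<psi> x" for x
    using \<psi>0 by (simp add: F'_def partial_deriv_def)
  have "integral\<^sup>L lborel (\<lambda>x. F' x b) = 0"
  proof (rule integral_directional_deriv_eq_0[OF _ _ K(1)])
    fix x
    show "((\<lambda>x. f x * \<psi> x) has_derivative F' x) (at x)"
    proof (cases "x \<in> K")
      case True
      then show ?thesis
        using has_derivative_mult[OF f D\<psi>, of x] K(2) by (auto simp: F'_def[abs_def])
    next
      case False
      have "((\<lambda>x. f x * \<psi> x) has_derivative (\<lambda>_. 0)) (at x)"
        by (rule has_derivative_transform_within_open[where f = "\<lambda>_. 0" and s = "- K"])
           (use False \<psi>0 compact_imp_closed[OF K(1)] in auto)
      then show ?thesis using False by (simp add: F'_def[abs_def])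
    qed
  qed (use c1 c2 \<psi>0 in \<open>auto simp: F'b intro!: continuous_on_add\<close>)
  then have "integral\<^sup>L lborel (\<lambda>x. f x * partial_deriv b \<psi> x) + integral\<^sup>L lborel (\<lambda>x. f' x b * \<psi> x) = 0"
    using i1 i2 by (simp add: F'b)
  then show ?thesis using on[OF c1] on[OF c2] \<psi>0 by simp
qed

section \<open>Functions with a conical singularity\<close>

text \<open>Functions of order \<open>a\<close> at the origin: the derivatives of order \<open>j \<le> n\<close> are
  \<open>O(|x| powr (a - j))\<close> on \<open>S\<close>.\<close>

primrec conical :: "nat \<Rightarrow> 'a::euclidean_space set \<Rightarrow> real \<Rightarrow> ('a \<Rightarrow> real) \<Rightarrow> bool" where
  "conical 0 S a f \<longleftrightarrow> continuous_on S f \<and> (\<exists>C\<ge>0. \<forall>x\<in>S. \<bar>f x\<bar> \<le> C * norm x powr a)"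
| "conical (Suc n) S a f \<longleftrightarrow> (\<exists>C\<ge>0. \<forall>x\<in>S. \<bar>f x\<bar> \<le> C * norm x powr a) \<and>
     (\<exists>D. (\<forall>x\<in>S. (f has_derivative (\<lambda>h. \<Sum>b\<in>Basis. (h \<bullet> b) * D b x)) (at x)) \<and>
          (\<forall>b\<in>Basis. conical n S (a - 1) (D b)))"

lemma conical_bound: "conical n S a f \<Longrightarrow> \<exists>C\<ge>0. \<forall>x\<in>S. \<bar>f x\<bar> \<le> C * norm x powr a"
  by (cases n) auto

lemma conical_continuous_on: "conical n S a f \<Longrightarrow> continuous_on S f"
  by (cases n) (auto intro!: continuous_at_imp_continuous_on intro: has_derivative_continuous)

lemma conical_SucD: "conical (Suc n) S a f \<Longrightarrow> conical n S a f"
proof (induction n arbitrary: a f)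
  case 0
  then show ?case using conical_continuous_on[OF 0] by auto
next
  case (Suc n)
  obtain D where
    D: "\<forall>x\<in>S. (f has_derivative (\<lambda>h. \<Sum>b\<in>Basis. (h \<bullet> b) * D b x)) (at x)"
      "\<forall>b\<in>Basis. conical (Suc n) S (a - 1) (D b)"
    using Suc.prems unfolding conical.simps(2)[of "Suc n"] by blast
  then have "\<forall>b\<in>Basis. conical n S (a - 1) (D b)" using Suc.IH by blast
  then show ?case using D(1) conical_bound[OF Suc.prems] unfolding conical.simps(2)[of n] by blast
qed

text \<open>In the unit ball \<open>norm x < 1\<close>, so lowering the exponent enlarges the bound;
  the same shift is inherited by all derivatives.\<close>

lemma conical_mono:
  assumes "S \<subseteq> ball 0 1" "a' \<le> a" "conical n S a f"
  shows "conical n S a' f"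
proof -
  have B: "\<exists>C\<ge>0. \<forall>x\<in>S. \<bar>f x\<bar> \<le> C * norm x powr a'"
    if B: "\<exists>C\<ge>0. \<forall>x\<in>S. \<bar>f x\<bar> \<le> C * norm x powr a" and "a' \<le> a" for a a' f
  proof -
    obtain C where C: "C \<ge> 0" "\<forall>x\<in>S. \<bar>f x\<bar> \<le> C * norm x powr a" using B by blast
    have "\<bar>f x\<bar> \<le> C * norm x powr a'" if "x \<in> S" for x
    proof -
      have "norm x < 1" using assms(1) that by auto
      then have "norm x powr a \<le> norm x powr a'" using \<open>a' \<le> a\<close> by (intro powr_mono') auto
      then show ?thesis using C that by (meson mult_left_mono order_trans)
    qed
    then show ?thesis using C(1) by blast
  qed
  show ?thesis using assms(2,3)
  proof (induction n arbitrary: a a' f)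
    case 0
    then show ?case using B[of f a a'] by simp
  next
    case (Suc n)
    have "conical n S (a' - 1) g" if "conical n S (a - 1) g" for g
      using Suc.IH[of "a' - 1" "a - 1" g] Suc.prems(1) that by simp
    then show ?case
      using B[of f a a'] Suc.prems unfolding conical.simps by blast
  qed
qed

lemma bound_add:
  assumes "\<exists>C\<ge>0. \<forall>x\<in>S. \<bar>f x\<bar> \<le> C * norm x powr a" "\<exists>C\<ge>0. \<forall>x\<in>S. \<bar>g x\<bar> \<le> C * norm x powr a"
  shows "\<exists>C\<ge>0. \<forall>x\<in>S. \<bar>f x + g x\<bar> \<le> C * norm x powr (a::real)"
proof -
  obtain C D where C: "C \<ge> 0" "\<And>x. x\<in>S \<Longrightarrow> \<bar>f x\<bar> \<le> C * norm x powr a"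
    and D: "D \<ge> 0" "\<And>x. x\<in>S \<Longrightarrow> \<bar>g x\<bar> \<le> D * norm x powr a" using assms by blast
  have "\<bar>f x + g x\<bar> \<le> (C + D) * norm x powr a" if "x \<in> S" for x
    using C(2)[OF that] D(2)[OF that] by (simp add: distrib_right)
  then show ?thesis using C(1) D(1) by (intro exI[of _ "C + D"]) auto
qed

lemma bound_mult:
  assumes "\<exists>C\<ge>0. \<forall>x\<in>S. \<bar>f x\<bar> \<le> C * norm x powr a" "\<exists>C\<ge>0. \<forall>x\<in>S. \<bar>g x\<bar> \<le> C * norm x powr b"
  shows "\<exists>C\<ge>0. \<forall>x\<in>S. \<bar>f x * g x\<bar> \<le> C * norm x powr (a + b::real)"
proof -
  obtain C D where C: "C \<ge> 0" "\<And>x. x\<in>S \<Longrightarrow> \<bar>f x\<bar> \<le> C * norm x powr a"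
    and D: "D \<ge> 0" "\<And>x. x\<in>S \<Longrightarrow> \<bar>g x\<bar> \<le> D * norm x powr b" using assms by blast
  have "\<bar>f x * g x\<bar> \<le> (C * D) * norm x powr (a + b)" if "x \<in> S" for x
    using mult_mono[OF C(2)[OF that] D(2)[OF that]] C(1)
    by (simp add: abs_mult powr_add mult_ac)
  then show ?thesis using C(1) D(1) by (intro exI[of _ "C * D"]) auto
qed

lemma conical_add: "conical n S a f \<Longrightarrow> conical n S a g \<Longrightarrow> conical n S a (\<lambda>x. f x + g x)"
proof (induction n arbitrary: a f g)
  case 0
  then show ?case using bound_add[of S f a g] by (auto intro: continuous_on_add)
next
  case (Suc n)
  obtain D E where
    D: "\<forall>x\<in>S. (f has_derivative (\<lambda>h. \<Sum>b\<in>Basis. (h \<bullet> b) * D b x)) (at x)" "\<forall>b\<in>Basis. conical n S (a - 1) (D b)"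
    and E: "\<forall>x\<in>S. (g has_derivative (\<lambda>h. \<Sum>b\<in>Basis. (h \<bullet> b) * E b x)) (at x)" "\<forall>b\<in>Basis. conical n S (a - 1) (E b)"
    using Suc.prems by auto
  have "\<forall>x\<in>S. ((\<lambda>x. f x + g x) has_derivative (\<lambda>h. \<Sum>b\<in>Basis. (h \<bullet> b) * (D b x + E b x))) (at x)"
    using D(1) E(1) by (auto simp: distrib_left sum.distrib intro!: has_derivative_add)
  moreover have "\<forall>b\<in>Basis. conical n S (a - 1) (\<lambda>x. D b x + E b x)"
    using D(2) E(2) Suc.IH by blast
  ultimately show ?case
    using bound_add[OF conical_bound conical_bound, OF Suc.prems] unfolding conical.simps
    by (intro conjI exI[of _ "\<lambda>b x. D b x + E b x"])
qed

text \<open>Induction by the product rule. Both summands of a partial derivative have order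
  \<open>a + c - 1\<close>, and the undifferentiated factor is brought down to \<open>n\<close>
  derivatives by \<open>conical_SucD\<close> to fit the induction hypothesis.\<close>

lemma conical_mult: "conical n S a f \<Longrightarrow> conical n S c g \<Longrightarrow> conical n S (a + c) (\<lambda>x. f x * g x)"
proof (induction n arbitrary: a c f g)
  case 0
  then show ?case using bound_mult[of S f a g c] by (auto intro: continuous_on_mult)
next
  case (Suc n)
  obtain D E where
    D: "\<forall>x\<in>S. (f has_derivative (\<lambda>h. \<Sum>b\<in>Basis. (h \<bullet> b) * D b x)) (at x)" "\<forall>b\<in>Basis. conical n S (a - 1) (D b)"
    and E: "\<forall>x\<in>S. (g has_derivative (\<lambda>h. \<Sum>b\<in>Basis. (h \<bullet> b) * E b x)) (at x)" "\<forall>b\<in>Basis. conical n S (c - 1) (E b)"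
    using Suc.prems by auto
  have "\<forall>x\<in>S. ((\<lambda>x. f x * g x) has_derivative (\<lambda>h. \<Sum>b\<in>Basis. (h \<bullet> b) * (f x * E b x + D b x * g x))) (at x)"
  proof
    fix x assume "x \<in> S"
    then show "((\<lambda>x. f x * g x) has_derivative (\<lambda>h. \<Sum>b\<in>Basis. (h \<bullet> b) * (f x * E b x + D b x * g x))) (at x)"
      using has_derivative_mult[OF D(1)[rule_format] E(1)[rule_format], of x]
      by (simp add: sum_distrib_left sum_distrib_right sum.distrib distrib_left mult_ac)
  qed
  moreover have "conical n S (a + c - 1) (\<lambda>x. f x * E b x + D b x * g x)" if b: "b \<in> Basis" for b
  proof (rule conical_add)
    show "conical n S (a + c - 1) (\<lambda>x. f x * E b x)"
      using Suc.IH[OF conical_SucD[OF Suc.prems(1)], of "c - 1" "E b"] E(2) b by (simp add: add_diff_eq)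
    show "conical n S (a + c - 1) (\<lambda>x. D b x * g x)"
      using Suc.IH[OF _ conical_SucD[OF Suc.prems(2)], of "a - 1" "D b"] D(2) b by (simp add: algebra_simps)
  qed
  ultimately show ?case
    using bound_mult[OF conical_bound conical_bound, OF Suc.prems] unfolding conical.simps
    by (intro conjI exI[of _ "\<lambda>b x. f x * E b x + D b x * g x"]) blast+
qed

lemma conical_zero: "conical n S a (\<lambda>_. 0)"
proof (induction n arbitrary: a)
  case (Suc n)
  then show ?case unfolding conical.simps by (intro conjI exI[of _ "\<lambda>_ _. 0"]) auto
qed auto

text \<open>The origin is excluded because \<open>0 powr 0 = 0\<close> would force the constant to
  vanish there.\<close>

lemma conical_const:
  assumes "0 \<notin> S"
  shows "conical n S 0 (\<lambda>_. c)"
proof (cases n)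
  case 0
  then show ?thesis using assms by (auto intro!: exI[of _ "\<bar>c\<bar>"])
next
  case (Suc m)
  have "\<exists>C\<ge>0. \<forall>x\<in>S. \<bar>c\<bar> \<le> C * norm x powr 0" using assms by (auto intro!: exI[of _ "\<bar>c\<bar>"])
  then show ?thesis
    unfolding Suc conical.simps by (intro conjI exI[of _ "\<lambda>_ _. 0"]) (auto simp: conical_zero)
qed

text \<open>The first direction is moved from the test function to \<open>f\<close> by parts, and
  the induction hypothesis treats the resulting partial derivative. \<open>N\<close> derivatives are
  kept in reserve because the energy estimate also needs the gradient of \<open>g\<close>, and the
  bounds are kept on all of \<open>S\<close> so that connecting paths may leave \<Omega>.\<close>

lemma conical_weak_deriv:
  assumes "open \<Omega>" "\<Omega> \<subseteq> S" "set bs \<subseteq> Basis" "conical (N + length bs) S a f"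
  shows "\<exists>g. conical N S (a - real (length bs)) g \<and> weak_deriv \<Omega> bs f g"
  using assms(3,4)
proof (induction bs arbitrary: a f)
  case Nil
  then show ?case by (auto simp: weak_deriv_def partials_def)
next
  case (Cons b bs)
  obtain D where
    D: "\<forall>x\<in>S. (f has_derivative (\<lambda>h. \<Sum>b\<in>Basis. (h \<bullet> b) * D b x)) (at x)"
      "\<forall>b\<in>Basis. conical (N + length bs) S (a - 1) (D b)"
    using Cons.prems by auto
  have b: "b \<in> Basis" using Cons.prems by simp
  have Db: "(\<Sum>b'\<in>Basis. (b \<bullet> b') * D b' x) = D b x" for x
  proof -
    have "(\<Sum>b'\<in>Basis. (b \<bullet> b') * D b' x) = (\<Sum>b'\<in>Basis. if b' = b then D b x else 0)"
      using b by (intro sum.cong) (auto simp: inner_Basis)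
    then show ?thesis using b by simp
  qed
  obtain g where g: "conical N S (a - 1 - real (length bs)) g" "weak_deriv \<Omega> bs (D b) g"
    using Cons.IH[of "a - 1" "D b"] Cons.prems D(2) b by auto
  have "weak_deriv \<Omega> (b # bs) f g"
    unfolding weak_deriv_def
  proof (intro allI impI)
    fix \<psi> assume \<psi>: "test_function \<Omega> \<psi>"
    have "integral\<^sup>L (lebesgue_on \<Omega>) (\<lambda>x. f x * partial_deriv b (partials bs \<psi>) x) =
      - integral\<^sup>L (lebesgue_on \<Omega>) (\<lambda>x. (\<Sum>b'\<in>Basis. (b \<bullet> b') * D b' x) * partials bs \<psi> x)"
    proof (rule weak_deriv_classical[OF assms(1) _ _ test_function_partials[OF \<psi>] b])
      show "(f has_derivative (\<lambda>h. \<Sum>b\<in>Basis. (h \<bullet> b) * D b x)) (at x)" if "x \<in> \<Omega>" for x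
        using D(1) that assms(2) by blast
      show "continuous_on \<Omega> (\<lambda>x. \<Sum>b'\<in>Basis. (b \<bullet> b') * D b' x)"
        unfolding Db using conical_continuous_on D(2) b assms(2) continuous_on_subset by blast
      show "set bs \<subseteq> Basis" using Cons.prems by simp
    qed
    then show "integral\<^sup>L (lebesgue_on \<Omega>) (\<lambda>x. f x * partials (b # bs) \<psi> x) =
      (-1) ^ length (b # bs) * integral\<^sup>L (lebesgue_on \<Omega>) (\<lambda>x. g x * \<psi> x)"
      using g(2) \<psi> by (simp add: Db weak_deriv_def partials_def)
  qed
  then show ?case using g(1) by (auto simp: algebra_simps)
qed

section \<open>Hoelder estimates along polygonal paths\<close>

definition poly_path :: "'a::euclidean_space set \<Rightarrow> 'a \<Rightarrow> 'a \<Rightarrow> real \<Rightarrow> bool" where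
  "poly_path S x y L \<longleftrightarrow> (\<exists>p n. p 0 = x \<and> p n = y \<and>
     (\<forall>i<n. closed_segment (p i) (p (Suc i)) \<subseteq> S) \<and> (\<Sum>i<n. dist (p i) (p (Suc i))) \<le> L)"

lemma poly_path_sym:
  assumes "poly_path S x y L"
  shows "poly_path S y x L"
proof -
  obtain p n where p: "p 0 = x" "p n = y" "\<forall>i<n. closed_segment (p i) (p (Suc i)) \<subseteq> S"
    "(\<Sum>i<n. dist (p i) (p (Suc i))) \<le> L"
    using assms unfolding poly_path_def by blast
  have "(\<Sum>i<n. dist (p (n - i)) (p (n - Suc i))) = (\<Sum>i<n. dist (p (n - Suc i)) (p (Suc (n - Suc i))))"
    by (intro sum.cong) (auto simp: dist_commute Suc_diff_Suc)
  also have "\<dots> = (\<Sum>i<n. dist (p i) (p (Suc i)))"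
    by (rule sum.nat_diff_reindex)
  finally have "(\<Sum>i<n. dist (p (n - i)) (p (n - Suc i))) \<le> L" using p(4) by simp
  moreover have "closed_segment (p (n - i)) (p (n - Suc i)) \<subseteq> S" if "i < n" for i
    using p(3)[rule_format, of "n - Suc i"] that by (simp add: closed_segment_commute Suc_diff_Suc)
  ultimately show ?thesis
    unfolding poly_path_def using p(1,2)
    by (intro exI[of _ "\<lambda>i. p (n - i)"] exI[of _ n]) auto
qed

lemma poly_path_segment: "closed_segment x y \<subseteq> S \<Longrightarrow> dist x y \<le> L \<Longrightarrow> poly_path S x y L"
  unfolding poly_path_def by (intro exI[of _ "\<lambda>i. if i = 0 then x else y"] exI[of _ "1::nat"]) auto

lemma poly_path_mono:
  assumes "poly_path S x y L" "S \<subseteq> T"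
  shows "poly_path T x y L"
proof -
  obtain p n where p: "p 0 = x" "p n = y" "(\<Sum>i<n. dist (p i) (p (Suc i))) \<le> L"
    "\<And>i. i < n \<Longrightarrow> closed_segment (p i) (p (Suc i)) \<subseteq> S"
    using assms(1) unfolding poly_path_def by blast
  then have "\<forall>i<n. closed_segment (p i) (p (Suc i)) \<subseteq> T" using assms(2) by blast
  then show ?thesis using p unfolding poly_path_def by blast
qed

text \<open>Every point of a path of length at most \<open>L\<close> from \<open>x\<close> has norm
  at least \<open>norm x - L\<close>. As \<open>a - 1\<close> is nonpositive, this bounds the
  gradient along the path, and the mean value theorem is summed over the segments.\<close>

lemma conical_lipschitz:
  assumes f: "conical (Suc n) S a g" and a: "a \<le> 1"
  obtains C where "C \<ge> 0"
    "\<And>x y L. poly_path S x y L \<Longrightarrow> L < norm x \<Longrightarrow> \<bar>g x - g y\<bar> \<le> C * (norm x - L) powr (a - 1) * L"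
proof -
  obtain D where
    D: "\<forall>x\<in>S. (g has_derivative (\<lambda>h. \<Sum>b\<in>Basis. (h \<bullet> b) * D b x)) (at x)"
      "\<forall>b\<in>Basis. conical n S (a - 1) (D b)"
    using f by auto
  have "\<forall>b\<in>Basis. \<exists>C\<ge>0. \<forall>x\<in>S. \<bar>D b x\<bar> \<le> C * norm x powr (a - 1)"
    using D(2) conical_bound by blast
  then obtain K where K: "\<And>b. b \<in> Basis \<Longrightarrow> K b \<ge> 0"
    "\<And>b x. b \<in> Basis \<Longrightarrow> x \<in> S \<Longrightarrow> \<bar>D b x\<bar> \<le> K b * norm x powr (a - 1)"
    by metis
  define C where "C = (\<Sum>b\<in>Basis. K b)"
  have C: "C \<ge> 0" unfolding C_def using K(1) by (simp add: sum_nonneg)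
  show ?thesis
  proof (rule that[OF C])
    fix x y L assume "poly_path S x y L" and L: "L < norm x"
    then obtain p n where p: "p 0 = x" "p n = y" "\<And>i. i < n \<Longrightarrow> closed_segment (p i) (p (Suc i)) \<subseteq> S"
      and len: "(\<Sum>i<n. dist (p i) (p (Suc i))) \<le> L"
      unfolding poly_path_def by blast
    define \<rho> where "\<rho> = norm x - L"
    have \<rho>: "\<rho> > 0" using L by (simp add: \<rho>_def)
    have far: "dist x (p i) \<le> (\<Sum>j<i. dist (p j) (p (Suc j)))" for i
    proof (induction i)
      case (Suc i)
      then show ?case using dist_triangle[of x "p (Suc i)" "p i"] by simp
    qed (simp add: p)
    have step: "\<bar>g (p i) - g (p (Suc i))\<bar> \<le> C * \<rho> powr (a - 1) * dist (p i) (p (Suc i))" if i: "i < n" for i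
    proof -
      have "norm (g (p i) - g (p (Suc i))) \<le> C * \<rho> powr (a - 1) * norm (p i - p (Suc i))"
      proof (rule differentiable_bound[where S = "closed_segment (p i) (p (Suc i))"])
        fix z assume z: "z \<in> closed_segment (p i) (p (Suc i))"
        then have zS: "z \<in> S" using p(3)[OF i] by blast
        show "(g has_derivative (\<lambda>h. \<Sum>b\<in>Basis. (h \<bullet> b) * D b z)) (at z within closed_segment (p i) (p (Suc i)))"
          using D(1) zS by (blast intro: has_derivative_at_withinI)
        have "dist x z \<le> dist x (p i) + dist (p i) z" by (rule dist_triangle)
        also have "dist (p i) z \<le> dist (p i) (p (Suc i))"
          using dist_in_closed_segment[OF z] by (simp add: dist_commute)
        also have "dist x (p i) + dist (p i) (p (Suc i)) \<le> (\<Sum>j<Suc i. dist (p j) (p (Suc j)))"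
          using far[of i] by simp
        also have "\<dots> \<le> (\<Sum>j<n. dist (p j) (p (Suc j)))"
          using i by (intro sum_mono2) auto
        finally have "dist x z \<le> L" using len by simp
        then have z\<rho>: "\<rho> \<le> norm z"
          using norm_triangle_ineq2[of x z] by (simp add: \<rho>_def dist_norm)
        have "\<bar>D b z\<bar> \<le> K b * \<rho> powr (a - 1)" if b: "b \<in> Basis" for b
        proof -
          have "norm z powr (a - 1) \<le> \<rho> powr (a - 1)"
            using \<rho> z\<rho> a by (intro powr_mono2') auto
          then show ?thesis using K[OF b] zS by (meson mult_left_mono order_trans)
        qed
        note Db = this
        show "onorm (\<lambda>h. \<Sum>b\<in>Basis. (h \<bullet> b) * D b z) \<le> C * \<rho> powr (a - 1)"
        proof (rule onorm_le)
          fix h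
          have "norm (\<Sum>b\<in>Basis. (h \<bullet> b) * D b z) \<le> (\<Sum>b\<in>Basis. norm h * (K b * \<rho> powr (a - 1)))"
            using Db by (intro sum_norm_le) (auto simp: abs_mult intro!: mult_mono Basis_le_norm)
          then show "norm (\<Sum>b\<in>Basis. (h \<bullet> b) * D b z) \<le> C * \<rho> powr (a - 1) * norm h"
            by (simp add: C_def sum_distrib_left sum_distrib_right mult_ac)
        qed
      qed auto
      then show ?thesis by (simp add: dist_norm)
    qed
    have "\<bar>g (p 0) - g (p n)\<bar> \<le> (\<Sum>i<n. \<bar>g (p i) - g (p (Suc i))\<bar>)"
    proof -
      have "g (p 0) - g (p n) = (\<Sum>i<n. g (p i) - g (p (Suc i)))"
        by (rule sum_lessThan_telescope'[symmetric])
      then show ?thesis by (simp add: sum_abs)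
    qed
    also have "\<dots> \<le> (\<Sum>i<n. C * \<rho> powr (a - 1) * dist (p i) (p (Suc i)))"
      by (intro sum_mono step) simp
    also have "\<dots> \<le> C * \<rho> powr (a - 1) * L"
      using len C by (simp add: sum_distrib_left[symmetric] mult_left_mono)
    finally show "\<bar>g x - g y\<bar> \<le> C * (norm x - L) powr (a - 1) * L" by (simp add: p \<rho>_def)
  qed
qed

text \<open>Interpolation between two regimes. If \<open>d\<close> is at least a fixed fraction of
  both norms, the size bound for each value suffices, and a factor
  \<open>norm x powr \<theta>\<close> is traded for \<open>d powr \<theta>\<close>. If
  \<open>d\<close> is small compared with the larger norm, the Lipschitz bound is applied from that
  endpoint and the surplus \<open>d powr (1 - \<theta>)\<close> is absorbed by its norm.\<close>

lemma conical_hoelder: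
  assumes g: "conical (Suc n) S b g" and b: "b \<le> 0" and \<theta>: "0 \<le> \<theta>" "\<theta> \<le> 1"
    and S: "0 \<notin> S" and c: "0 < c"
  obtains C where "C \<ge> 0"
    "\<And>x y d. x \<in> S \<Longrightarrow> y \<in> S \<Longrightarrow> 0 < d \<Longrightarrow>
      c * max (norm x) (norm y) \<le> d \<or> poly_path S x y (2 * d) \<Longrightarrow>
      \<bar>g x - g y\<bar> \<le> C * d powr \<theta> * (norm x powr (b - \<theta>) + norm y powr (b - \<theta>))"
proof -
  obtain K where K: "K \<ge> 0" "\<And>x. x \<in> S \<Longrightarrow> \<bar>g x\<bar> \<le> K * norm x powr b"
    using conical_bound[OF g] by blast
  obtain Q where Q: "Q \<ge> 0"
    "\<And>x y L. poly_path S x y L \<Longrightarrow> L < norm x \<Longrightarrow> \<bar>g x - g y\<bar> \<le> Q * (norm x - L) powr (b - 1) * L"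
    using conical_lipschitz[OF g] b by auto
  \<comment> \<open>With the bound 1/4, a path of length \<open>2 * d\<close> from the endpoint of
    larger norm stays outside the ball of half that norm. With \<open>c' \<le> c\<close>, the
    failure of the first regime rules out the first alternative of the hypothesis and leaves the
    path.\<close>
  define c' where "c' = min c (1/4)"
  have c': "0 < c'" "c' \<le> c" "c' \<le> 1/4" using c by (auto simp: c'_def)
  define A where "A = K * (1 / c') powr \<theta>"
  define B where "B = 2 * Q * (1/2) powr (b - 1)"
  have AB: "0 \<le> A" "0 \<le> B" using K(1) Q(1) by (auto simp: A_def B_def)
  have far: "\<bar>g x\<bar> \<le> A * d powr \<theta> * norm x powr (b - \<theta>)" if "x \<in> S" "c' * norm x \<le> d" for x d
  proof -
    have "norm x \<le> (1 / c') * d" using that(2) c' by (simp add: field_simps)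
    then have "norm x powr \<theta> \<le> ((1 / c') * d) powr \<theta>" using \<theta> by (intro powr_mono2) auto
    also have "\<dots> = (1 / c') powr \<theta> * d powr \<theta>"
      using c' order_trans[OF _ that(2), of 0] by (intro powr_mult)
    finally have "norm x powr \<theta> \<le> (1 / c') powr \<theta> * d powr \<theta>" .
    then have "norm x powr \<theta> * norm x powr (b - \<theta>) \<le> (1 / c') powr \<theta> * d powr \<theta> * norm x powr (b - \<theta>)"
      by (intro mult_right_mono) auto
    then have "norm x powr b \<le> (1 / c') powr \<theta> * d powr \<theta> * norm x powr (b - \<theta>)"
      by (simp add: powr_add[symmetric])
    from mult_left_mono[OF this K(1)] show ?thesis
      using K(2)[OF that(1)] by (simp add: A_def mult_ac)
  qed
  have near: "\<bar>g x - g y\<bar> \<le> B * d powr \<theta> * norm x powr (b - \<theta>)"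
    if "x \<in> S" "0 < d" "d \<le> norm x / 4" "poly_path S x y (2 * d)" for x y d
  proof -
    have x: "0 < norm x" using that(2,3) by linarith
    have "\<bar>g x - g y\<bar> \<le> Q * (norm x - 2 * d) powr (b - 1) * (2 * d)"
      using Q(2)[OF that(4)] that x by simp
    also have "(norm x - 2 * d) powr (b - 1) \<le> ((1/2) * norm x) powr (b - 1)"
      using that x b by (intro powr_mono2') auto
    also have "((1/2) * norm x) powr (b - 1) = (1/2) powr (b - 1) * norm x powr (b - 1)"
      by (rule powr_mult)
    also have "2 * d = 2 * (d powr \<theta> * d powr (1 - \<theta>))"
      using that(2) by (simp add: powr_add[symmetric])
    also have "d powr (1 - \<theta>) \<le> norm x powr (1 - \<theta>)"
      using that x \<theta> by (intro powr_mono2) auto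
    finally have "\<bar>g x - g y\<bar> \<le> Q * ((1/2) powr (b - 1) * norm x powr (b - 1)) * (2 * (d powr \<theta> * norm x powr (1 - \<theta>)))"
      using Q(1) that by (simp add: mult_left_mono mult_right_mono)
    also have "\<dots> = B * d powr \<theta> * (norm x powr (b - 1) * norm x powr (1 - \<theta>))"
      by (simp add: B_def mult_ac)
    also have "norm x powr (b - 1) * norm x powr (1 - \<theta>) = norm x powr (b - \<theta>)"
      by (simp add: powr_add[symmetric])
    finally show ?thesis .
  qed
  show ?thesis
  proof (rule that[of "A + B"])
    fix x y d assume xy: "x \<in> S" "y \<in> S" and d: "0 < d"
      and pair: "c * max (norm x) (norm y) \<le> d \<or> poly_path S x y (2 * d)"
    define X where "X = d powr \<theta> * norm x powr (b - \<theta>)"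
    define Y where "Y = d powr \<theta> * norm y powr (b - \<theta>)"
    have XY: "0 \<le> X" "0 \<le> Y" by (auto simp: X_def Y_def)
    have "\<bar>g x - g y\<bar> \<le> A * (X + Y) + B * (X + Y)"
    proof (cases "c' * max (norm x) (norm y) \<le> d")
      case True
      have "c' * norm x \<le> d" "c' * norm y \<le> d"
        using True c' by (meson max.cobounded1 max.cobounded2 mult_left_mono order_trans less_imp_le)+
      then have "\<bar>g x\<bar> \<le> A * X" "\<bar>g y\<bar> \<le> A * Y"
        using far xy by (auto simp: X_def Y_def mult_ac)
      then have "\<bar>g x - g y\<bar> \<le> A * (X + Y)" by (simp add: distrib_left)
      then show ?thesis using AB XY by (simp add: add_increasing2)
    next
      case False
      have m: "c' * max (norm x) (norm y) \<le> c * max (norm x) (norm y)"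
        "c' * max (norm x) (norm y) \<le> 1/4 * max (norm x) (norm y)"
        using c' by (intro mult_right_mono; simp add: le_max_iff_disj)+
      then have p: "poly_path S x y (2 * d)" and dm: "d \<le> max (norm x) (norm y) / 4"
        using False pair by linarith+
      have "\<bar>g x - g y\<bar> \<le> B * (X + Y)"
      proof (cases "norm y \<le> norm x")
        case True
        then have "\<bar>g x - g y\<bar> \<le> B * X"
          using near[OF xy(1) d _ p] dm by (simp add: X_def mult_ac)
        then show ?thesis using AB XY by (simp add: distrib_left add_increasing2)
      next
        case False
        then have "\<bar>g y - g x\<bar> \<le> B * Y"
          using near[OF xy(2) d _ poly_path_sym[OF p]] dm by (simp add: Y_def mult_ac)
        then show ?thesis using AB XY by (simp add: distrib_left abs_minus_commute add_increasing)
      qed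
      then show ?thesis using AB XY by (simp add: add_increasing)
    qed
    then show "\<bar>g x - g y\<bar> \<le> (A + B) * d powr \<theta> * (norm x powr (b - \<theta>) + norm y powr (b - \<theta>))"
      by (simp add: X_def Y_def algebra_simps)
  qed (use AB in auto)
qed

section \<open>Finiteness of the energy of conical functions\<close>

lemma power2_le_if_abs_le:
  fixes p q :: real
  assumes "\<bar>p\<bar> \<le> q"
  shows "p\<^sup>2 \<le> q\<^sup>2"
  using power_mono[OF assms, of 2] by simp

text \<open>\<theta> is the Hoelder exponent. For pairs across a slit, \<tau> divides the
  singularity \<open>norm x powr (2 * b)\<close> between the direction along the slit and the one
  normal to it. The normal direction also carries \<open>2 * \<theta>\<close>, and both exponents
  must stay below 1 for integrability.\<close>

lemma exponent_choice:
  fixes b \<sigma> :: real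
  assumes "b \<le> 0" "0 < \<sigma>" "\<sigma> < b + 1"
  obtains \<theta> \<tau> where "\<sigma> < \<theta>" "\<theta> < b + 1" "0 \<le> \<tau>" "\<tau> \<le> 1 \<or> \<sigma> \<ge> 1/2"
    "- 2 * b * \<tau> < 1" "\<sigma> < 1/2 \<Longrightarrow> - 2 * b * (1 - \<tau>) + 2 * \<theta> < 1"
proof -
  \<comment> \<open>This solves \<open>(2 - 2 * \<sigma>) * \<tau> = 1\<close>, so
    \<open>- b < 1 - \<sigma>\<close> gives the bound on \<open>- 2 * b * \<tau>\<close>. The
    identity \<open>1 - \<tau> = (1 - 2 * \<sigma>) * \<tau>\<close> then leaves room above
    \<open>2 * \<sigma>\<close> in the other exponent.\<close>
  define \<tau> where "\<tau> = 1 / (2 - 2 * \<sigma>)"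
  have s: "\<sigma> < 1" using assms by linarith
  have 1: "- 2 * b * \<tau> < 1" using assms s by (simp add: \<tau>_def field_simps)
  have 2: "2 * \<sigma> < 1 - (- 2 * b * (1 - \<tau>))" if "\<sigma> < 1/2"
  proof -
    have "1 - \<tau> = (1 - 2 * \<sigma>) * \<tau>" using s by (simp add: \<tau>_def field_simps)
    then have "- 2 * b * (1 - \<tau>) = (1 - 2 * \<sigma>) * (- 2 * b * \<tau>)" by simp
    also have "\<dots> < (1 - 2 * \<sigma>) * 1" using that 1 by (intro mult_strict_left_mono) auto
    finally show ?thesis by simp
  qed
  define m where "m = (if \<sigma> < 1/2 then min (b + 1) ((1 - (- 2 * b * (1 - \<tau>))) / 2) else b + 1)"
  have "\<sigma> < m" using 2 assms by (auto simp: m_def)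
  then obtain \<theta> where "\<sigma> < \<theta>" "\<theta> < m" using dense by blast
  then show ?thesis
    using 1 s by (intro that[of \<theta> \<tau>]) (auto simp: m_def \<tau>_def split: if_splits)
qed

text \<open>The third alternative in the hypothesis \<open>pair\<close> is for pairs of points separated by a slit in the
  hyperplane orthogonal to \<open>v\<close>, across which \<open>g\<close> may jump.\<close>

lemma slobodeckij_energy_conical:
  fixes \<Omega> :: "'a::euclidean_space set"
  assumes dim: "DIM('a) = 2"
    and \<Omega>: "\<Omega> \<in> sets borel" "\<Omega> \<subseteq> S" and S: "S \<subseteq> ball 0 1" "0 \<notin> S"
    and g: "conical (Suc n) S b g" and b: "b \<le> 0" and \<sigma>: "0 < \<sigma>" "\<sigma> < b + 1"
    and c: "0 < c" and v: "v \<in> Basis"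
    and d: "\<And>x y. x \<in> \<Omega> \<Longrightarrow> y \<in> \<Omega> \<Longrightarrow> dist x y \<le> d x y"
    and pair: "\<And>x y. x \<in> \<Omega> \<Longrightarrow> y \<in> \<Omega> \<Longrightarrow> x \<noteq> y \<Longrightarrow>
      c * max (norm x) (norm y) \<le> d x y \<or> poly_path S x y (2 * d x y) \<or>
      \<sigma> < 1/2 \<and> \<bar>x \<bullet> v\<bar> \<le> d x y \<and> \<bar>y \<bullet> v\<bar> \<le> d x y"
  shows "slobodeckij_energy d \<Omega> \<sigma> g < \<infinity>"
proof -
  obtain \<theta> \<tau> where \<theta>: "\<sigma> < \<theta>" "\<theta> < b + 1" and \<tau>: "0 \<le> \<tau>" "\<tau> \<le> 1 \<or> \<sigma> \<ge> 1/2"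
    "- 2 * b * \<tau> < 1" "\<sigma> < 1/2 \<Longrightarrow> - 2 * b * (1 - \<tau>) + 2 * \<theta> < 1"
    using exponent_choice[OF b \<sigma>] by metis
  \<comment> \<open>In dimension 2, \<open>D powr (2 * \<theta>)\<close> divided by the denominator
    of the seminorm is \<open>D powr (- (2 * \<eta>))\<close>, which gives each coordinate the
    exponent \<eta>. It is below 1 because \<open>\<theta> > \<sigma>\<close>.\<close>
  define \<eta> where "\<eta> = 1 + \<sigma> - \<theta>"
  have \<theta>01: "0 \<le> \<theta>" "\<theta> \<le> 1" using \<theta> \<sigma> b by auto
  have \<eta>: "0 \<le> \<eta>" "\<eta> < 1" using \<theta> \<theta>01 \<sigma> by (auto simp: \<eta>_def)
  obtain C where C: "C \<ge> 0"
    "\<And>x y d. x \<in> S \<Longrightarrow> y \<in> S \<Longrightarrow> 0 < d \<Longrightarrow>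
      c * max (norm x) (norm y) \<le> d \<or> poly_path S x y (2 * d) \<Longrightarrow>
      \<bar>g x - g y\<bar> \<le> C * d powr \<theta> * (norm x powr (b - \<theta>) + norm y powr (b - \<theta>))"
    using conical_hoelder[OF g b \<theta>01 S(2) c] by metis
  obtain K where K: "K \<ge> 0" "\<And>x. x \<in> S \<Longrightarrow> \<bar>g x\<bar> \<le> K * norm x powr b"
    using conical_bound[OF g] by blast
  have "card (Basis - {v}) = 1" using dim v by simp
  then obtain v' where v': "Basis - {v} = {v'}" by (rule card_1_singletonE)
  have Bs: "(Basis :: 'a set) = {v, v'}" "v \<noteq> v'" using v v' by auto
  \<comment> \<open>\<open>W1\<close> is the weight from the Hoelder bound and \<open>W2\<close> the
    one for pairs across the slit. In \<open>W2\<close> the factor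
    \<open>D powr (- 2 * \<theta>)\<close> is charged wholly to the normal coordinate, which is at
    most \<open>D\<close>. For \<open>\<sigma> \<ge> 1/2\<close> the third alternative of
    \<open>pair\<close> cannot occur, so \<open>W2\<close> is then 0.\<close>
  define e where "e w = (if w = v then - 2 * b * (1 - \<tau>) + 2 * \<theta> else - 2 * b * \<tau>)" for w
  define W1 where "W1 = box_kern (\<lambda>_::'a. \<theta> - b)"
  define W2 where "W2 = (if \<sigma> < 1/2 then box_kern e else (\<lambda>_. 0))"
  define W where "W x = W1 x + W2 x" for x
  have W1: "ennreal (norm x powr (2 * (b - \<theta>))) \<le> W1 x" if "x \<noteq> 0" for x
    using norm_powr_le_box_kern[OF that, of "\<lambda>_. \<theta> - b"] b \<theta>01 dim by (simp add: W1_def algebra_simps)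
  have W2: "ennreal (norm x powr (2 * b) * D powr (- 2 * \<theta>)) \<le> W2 x"
    if "x \<noteq> 0" "\<sigma> < 1/2" "\<bar>x \<bullet> v\<bar> \<le> D" "0 < D" for x D
  proof -
    have l1: "0 \<le> - 2 * b * (1 - \<tau>)" using b \<tau> that(2) by (auto intro: mult_nonpos_nonneg)
    have nx: "0 < norm x" using that(1) by simp
    have "norm x powr (2 * b) * D powr (- 2 * \<theta>) =
      (norm x powr (- (- 2 * b * (1 - \<tau>))) * D powr (- (2 * \<theta>))) * norm x powr (- (- 2 * b * \<tau>))"
      using nx by (simp add: powr_add[symmetric] algebra_simps)
    also have "ennreal \<dots> = ennreal (norm x powr (- (- 2 * b * (1 - \<tau>))) * D powr (- (2 * \<theta>)))
      * ennreal (norm x powr (- (- 2 * b * \<tau>)))"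
      by (rule ennreal_mult) auto
    also have "\<dots> \<le> kern (- 2 * b * (1 - \<tau>) + 2 * \<theta>) (x \<bullet> v) * kern (- 2 * b * \<tau>) (x \<bullet> v')"
    proof (rule mult_mono)
      show "ennreal (norm x powr (- (- 2 * b * \<tau>))) \<le> kern (- 2 * b * \<tau>) (x \<bullet> v')"
        using b \<tau>(1) Bs by (intro kern_ge Basis_le_norm) (auto intro: mult_nonneg_nonpos)
      show "ennreal (norm x powr (- (- 2 * b * (1 - \<tau>))) * D powr (- (2 * \<theta>)))
        \<le> kern (- 2 * b * (1 - \<tau>) + 2 * \<theta>) (x \<bullet> v)"
      proof (cases "x \<bullet> v = 0")
        case False
        have "norm x powr (- (- 2 * b * (1 - \<tau>))) * D powr (- (2 * \<theta>)) \<le>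
          \<bar>x \<bullet> v\<bar> powr (- (- 2 * b * (1 - \<tau>))) * \<bar>x \<bullet> v\<bar> powr (- (2 * \<theta>))"
          using False that l1 \<theta>01 v Basis_le_norm[OF v, of x]
          by (intro mult_mono powr_mono2') auto
        also have "\<dots> = \<bar>x \<bullet> v\<bar> powr (- (- 2 * b * (1 - \<tau>) + 2 * \<theta>))"
          by (simp add: powr_add[symmetric] algebra_simps)
        finally show ?thesis using False by (simp add: kern_def)
      qed (simp add: kern_def)
    qed auto
    also have "\<dots> = W2 x"
      using that(2) Bs(2) unfolding W2_def box_kern_def Bs(1) by (simp add: e_def)
    finally show ?thesis .
  qed
  show ?thesis
  proof (rule slobodeckij_energy_finite[where e = "\<lambda>_. \<eta>" and W = W and C = "2 * C\<^sup>2 + 2 * K\<^sup>2"])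
    show "\<Omega> \<in> sets borel" "\<Omega> \<subseteq> ball 0 1" "\<eta> < 1" using \<Omega> S \<eta> by auto
    have [measurable]: "W1 \<in> borel_measurable borel" "W2 \<in> borel_measurable borel"
      by (auto simp: W1_def W2_def)
    show "W \<in> borel_measurable borel" unfolding W_def[abs_def] by measurable
    have "(\<integral>\<^sup>+x. W1 x * indicator (ball 0 1) x \<partial>lborel) < \<infinity>"
      unfolding W1_def using \<theta> by (intro box_kern_integral_finite) auto
    moreover have "(\<integral>\<^sup>+x. W2 x * indicator (ball 0 1) x \<partial>lborel) < \<infinity>"
      using \<tau> box_kern_integral_finite[of e] by (auto simp: W2_def e_def)
    ultimately show "(\<integral>\<^sup>+x. W x * indicator (ball 0 1) x \<partial>lborel) < \<infinity>"
      unfolding W_def distrib_right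
      by (subst nn_integral_add) (auto intro!: borel_measurable_times_ennreal borel_measurable_indicator)
    fix x y assume xy: "x \<in> \<Omega>" "y \<in> \<Omega>"
    then have n0: "x \<noteq> 0" "y \<noteq> 0" and xyS: "x \<in> S" "y \<in> S" using \<Omega> S by auto
    show "ennreal ((g x - g y)\<^sup>2 / d x y powr (real DIM('a) + 2 * \<sigma>)) \<le>
      ennreal (2 * C\<^sup>2 + 2 * K\<^sup>2) * ((W x + W y) * box_kern (\<lambda>_. \<eta>) (x - y))"
    proof (cases "x = y")
      case False
      define D where "D = d x y"
      have D: "0 < norm (x - y)" "norm (x - y) \<le> D" "0 < D"
        using False d[OF xy] order_less_le_trans[of 0 "norm (x - y)" D]
        by (auto simp: D_def dist_norm)
      have "D powr (- (2 * \<eta>)) \<le> norm (x - y) powr (- (2 * \<eta>))"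
        using D \<eta> by (intro powr_mono2') auto
      also have "ennreal \<dots> \<le> box_kern (\<lambda>_. \<eta>) (x - y)"
        using norm_powr_le_box_kern[of "x - y" "\<lambda>_. \<eta>"] False \<eta> dim by simp
      finally have ker: "ennreal (D powr (- (2 * \<eta>))) \<le> box_kern (\<lambda>_. \<eta>) (x - y)"
        by (simp add: ennreal_leI)
      have sq: "(p + q)\<^sup>2 \<le> 2 * (p\<^sup>2 + q\<^sup>2)" for p q :: real
        using sum_squares_bound[of p q] by (simp add: power2_eq_square algebra_simps)
      have pw: "(t powr r)\<^sup>2 = t powr (2 * r)" for t r :: real
        by (simp add: power2_eq_square powr_add[symmetric])
      have final: ?thesis if P: "(g x - g y)\<^sup>2 \<le> M * (X + Y) * D powr (2 * \<theta>)" "0 \<le> X" "0 \<le> Y" "0 \<le> M"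
        "M \<le> 2 * C\<^sup>2 + 2 * K\<^sup>2"
        "ennreal X \<le> W x" "ennreal Y \<le> W y" for M X Y
      proof -
        have "(g x - g y)\<^sup>2 / D powr (real DIM('a) + 2 * \<sigma>) = (g x - g y)\<^sup>2 * D powr (- (2 + 2 * \<sigma>))"
          unfolding powr_minus by (simp add: dim divide_inverse)
        also have "\<dots> \<le> M * (X + Y) * D powr (2 * \<theta>) * D powr (- (2 + 2 * \<sigma>))"
          using P(1) by (intro mult_right_mono) auto
        also have "\<dots> = M * (X + Y) * D powr (- (2 * \<eta>))"
          by (simp add: powr_add[symmetric] \<eta>_def algebra_simps)
        also have "\<dots> \<le> (2 * C\<^sup>2 + 2 * K\<^sup>2) * (X + Y) * D powr (- (2 * \<eta>))"
          using P by (intro mult_right_mono) auto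
        finally have "ennreal ((g x - g y)\<^sup>2 / D powr (real DIM('a) + 2 * \<sigma>)) \<le>
          ennreal ((2 * C\<^sup>2 + 2 * K\<^sup>2) * (X + Y) * D powr (- (2 * \<eta>)))" by (rule ennreal_leI)
        also have "\<dots> = ennreal (2 * C\<^sup>2 + 2 * K\<^sup>2) * ((ennreal X + ennreal Y) * ennreal (D powr (- (2 * \<eta>))))"
          using P by (simp add: ennreal_mult[symmetric] ennreal_plus[symmetric] mult.assoc del: ennreal_plus)
        also have "\<dots> \<le> ennreal (2 * C\<^sup>2 + 2 * K\<^sup>2) * ((W x + W y) * box_kern (\<lambda>_. \<eta>) (x - y))"
          using P ker by (intro mult_left_mono mult_mono add_mono) auto
        finally show ?thesis by (simp add: D_def)
      qed
      show ?thesis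
      proof (cases "c * max (norm x) (norm y) \<le> D \<or> poly_path S x y (2 * D)")
        case True
        let ?X = "norm x powr (b - \<theta>)" and ?Y = "norm y powr (b - \<theta>)"
        have "(g x - g y)\<^sup>2 \<le> (C * D powr \<theta> * (?X + ?Y))\<^sup>2"
          using C(2)[OF xyS D(3) True] by (intro power2_le_if_abs_le) simp
        also have "\<dots> = C\<^sup>2 * D powr (2 * \<theta>) * (?X + ?Y)\<^sup>2"
          by (simp add: power_mult_distrib pw)
        also have "\<dots> \<le> C\<^sup>2 * D powr (2 * \<theta>) * (2 * (?X\<^sup>2 + ?Y\<^sup>2))"
          by (intro mult_left_mono sq) auto
        also have "\<dots> = 2 * C\<^sup>2 * (norm x powr (2 * (b - \<theta>)) + norm y powr (2 * (b - \<theta>))) * D powr (2 * \<theta>)"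
          by (simp add: pw)
        finally show ?thesis
          using W1[OF n0(1)] W1[OF n0(2)] by (intro final) (auto simp: W_def intro: add_increasing2)
      next
        \<comment> \<open>Across the slit only the size of the two values is used. The factor
          \<open>D powr (2 * \<theta>)\<close> is inserted to reach the form of
          \<open>final\<close>, and its inverse goes into \<open>W2\<close>.\<close>
        case False
        then have sl: "\<sigma> < 1/2" "\<bar>x \<bullet> v\<bar> \<le> D" "\<bar>y \<bullet> v\<bar> \<le> D"
          using pair[OF xy \<open>x \<noteq> y\<close>] by (auto simp: D_def)
        let ?X = "norm x powr b" and ?Y = "norm y powr b"
        have "\<bar>g x - g y\<bar> \<le> K * (?X + ?Y)"
          using K(2)[OF xyS(1)] K(2)[OF xyS(2)] by (simp add: distrib_left)
        then have "(g x - g y)\<^sup>2 \<le> (K * (?X + ?Y))\<^sup>2" by (intro power2_le_if_abs_le)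
        also have "\<dots> = K\<^sup>2 * (?X + ?Y)\<^sup>2" by (simp add: power_mult_distrib)
        also have "\<dots> \<le> K\<^sup>2 * (2 * (?X\<^sup>2 + ?Y\<^sup>2))"
          by (intro mult_left_mono sq) auto
        also have "\<dots> = 2 * K\<^sup>2 * (norm x powr (2 * b) + norm y powr (2 * b))"
          by (simp add: pw)
        also have "\<dots> = 2 * K\<^sup>2 * (norm x powr (2 * b) * D powr (- 2 * \<theta>) + norm y powr (2 * b) * D powr (- 2 * \<theta>))
            * D powr (2 * \<theta>)"
          using D by (simp add: powr_minus field_simps)
        finally show ?thesis
          using W2[OF n0(1) sl(1,2) D(3)] W2[OF n0(2) sl(1,3) D(3)]
          by (intro final) (auto simp: W_def intro: add_increasing)
      qed
    qed simp
  qed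
qed

text \<open>The square is bounded by a multiple of \<open>norm x powr (2 * b)\<close>, divided
  evenly between the two coordinates with exponent \<open>- b < 1\<close> each. The order is first
  cut down to at most 0 because \<open>norm_powr_le_box_kern\<close> takes nonnegative
  exponents.\<close>

lemma conical_L2:
  fixes \<Omega> :: "'a::euclidean_space set"
  assumes dim: "DIM('a) = 2"
    and \<Omega>: "\<Omega> \<in> sets borel" "\<Omega> \<subseteq> S" and S: "S \<subseteq> ball 0 1" "0 \<notin> S"
    and g: "conical n S a g" and a: "-1 < a"
  shows "g \<in> L2 \<Omega>"
proof -
  define b where "b = min a 0"
  have b: "-1 < b" "b \<le> 0" using a by (auto simp: b_def)
  have "conical n S b g" using conical_mono[OF S(1) _ g, of b] by (simp add: b_def)
  then obtain K where K: "K \<ge> 0" "\<And>x. x \<in> S \<Longrightarrow> \<bar>g x\<bar> \<le> K * norm x powr b"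
    using conical_bound by blast
  have [measurable]: "g \<in> borel_measurable (lebesgue_on \<Omega>)"
    using conical_continuous_on[OF g] \<Omega>
    by (intro continuous_imp_measurable_on_sets_lebesgue) (auto intro: continuous_on_subset)
  have "(\<integral>\<^sup>+x. ennreal (norm ((g x)\<^sup>2)) \<partial>lebesgue_on \<Omega>) =
    (\<integral>\<^sup>+x. ennreal (norm ((g x)\<^sup>2)) * indicator \<Omega> x \<partial>lborel)"
    using \<Omega>(1) by (simp add: nn_integral_restrict_space nn_integral_completion)
  also have "\<dots> \<le> (\<integral>\<^sup>+(x::'a). ennreal (K\<^sup>2) * (box_kern (\<lambda>_. - b) x * indicator (ball 0 1) x) \<partial>lborel)"
  proof (intro nn_integral_mono)
    fix x :: 'a
    show "ennreal (norm ((g x)\<^sup>2)) * indicator \<Omega> x \<le>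
      ennreal (K\<^sup>2) * (box_kern (\<lambda>_. - b) x * indicator (ball 0 1) x)"
    proof (cases "x \<in> \<Omega>")
      case True
      then have x: "x \<in> S" "x \<noteq> 0" "x \<in> ball 0 1" using \<Omega> S by auto
      have "(g x)\<^sup>2 \<le> (K * norm x powr b)\<^sup>2"
        using K(2)[OF x(1)] by (intro power2_le_if_abs_le)
      also have "\<dots> = K\<^sup>2 * norm x powr (- (\<Sum>w\<in>(Basis::'a set). - b))"
        using dim by (simp add: power_mult_distrib power2_eq_square powr_add[symmetric])
      finally have "ennreal ((g x)\<^sup>2) \<le> ennreal (K\<^sup>2) * ennreal (norm x powr (- (\<Sum>w\<in>(Basis::'a set). - b)))"
        by (simp add: ennreal_leI flip: ennreal_mult)
      also have "\<dots> \<le> ennreal (K\<^sup>2) * box_kern (\<lambda>_. - b) x"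
        using x b by (intro mult_left_mono norm_powr_le_box_kern) auto
      finally show ?thesis using x True by simp
    qed auto
  qed
  also have "\<dots> = ennreal (K\<^sup>2) * (\<integral>\<^sup>+(x::'a). box_kern (\<lambda>_. - b) x * indicator (ball 0 1) x \<partial>lborel)"
    by (rule nn_integral_cmult) (auto intro!: borel_measurable_times_ennreal borel_measurable_indicator)
  also have "\<dots> < \<infinity>"
    using box_kern_integral_finite[of "\<lambda>_::'a. - b"] b by (simp add: ennreal_mult_less_top)
  finally have "integrable (lebesgue_on \<Omega>) (\<lambda>x. (g x)\<^sup>2)"
    by (intro integrableI_bounded) auto
  then show ?thesis by (simp add: L2_def)
qed

text \<open>Derivatives up to order \<lfloor>s\<rfloor> are conical of order above -1, hence in
  \<open>L2\<close>. Those of top order come with one further derivative and so satisfy the energy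
  estimate.\<close>

lemma sobolev_slobodeckij_conical:
  fixes \<Omega> :: "'a::euclidean_space set"
  assumes dim: "DIM('a) = 2"
    and \<Omega>: "open \<Omega>" "\<Omega> \<subseteq> S" and S: "S \<subseteq> ball 0 1" "0 \<notin> S"
    and f: "\<And>N. conical N S \<nu> f" and u: "\<And>x. x \<in> \<Omega> \<Longrightarrow> u x = f x"
    and s: "0 \<le> s" "s < \<nu> + 1"
    and c: "0 < c" and v: "v \<in> Basis"
    and d: "\<And>x y. x \<in> \<Omega> \<Longrightarrow> y \<in> \<Omega> \<Longrightarrow> dist x y \<le> d x y"
    and pair: "\<And>x y. x \<in> \<Omega> \<Longrightarrow> y \<in> \<Omega> \<Longrightarrow> x \<noteq> y \<Longrightarrow>
      c * max (norm x) (norm y) \<le> d x y \<or> poly_path S x y (2 * d x y) \<or>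
      frac s < 1/2 \<and> \<bar>x \<bullet> v\<bar> \<le> d x y \<and> \<bar>y \<bullet> v\<bar> \<le> d x y"
  shows "u \<in> sobolev_slobodeckij d \<Omega> s"
proof -
  define n where "n = nat \<lfloor>s\<rfloor>"
  have sn: "s = real n + frac s" using s(1) by (simp add: n_def frac_def)
  have fs: "0 \<le> frac s" "frac s < 1" by (auto simp: frac_lt_1)
  have \<Omega>b: "\<Omega> \<in> sets borel" using \<Omega>(1) by simp
  \<comment> \<open>\<open>u\<close> is prescribed only on \<Omega>, and the weak derivative sees
    only its values there, so \<open>f\<close> may take its place.\<close>
  have cong: "weak_deriv \<Omega> bs u g = weak_deriv \<Omega> bs f g" for bs g
  proof -
    have "integral\<^sup>L (lebesgue_on \<Omega>) (\<lambda>x. u x * p x) = integral\<^sup>L (lebesgue_on \<Omega>) (\<lambda>x. f x * p x)" for p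
      using u by (intro Bochner_Integration.integral_cong) (auto simp: space_restrict_space)
    then show ?thesis by (simp add: weak_deriv_def)
  qed
  have "f \<in> L2 \<Omega>" using s by (intro conical_L2[OF dim \<Omega>b \<Omega>(2) S f[of 0]]) auto
  moreover have "u \<in> borel_measurable (lebesgue_on \<Omega>) \<longleftrightarrow> f \<in> borel_measurable (lebesgue_on \<Omega>)"
    using u by (intro measurable_cong) (auto simp: space_restrict_space)
  moreover have "integrable (lebesgue_on \<Omega>) (\<lambda>x. (u x)\<^sup>2) \<longleftrightarrow> integrable (lebesgue_on \<Omega>) (\<lambda>x. (f x)\<^sup>2)"
    using u by (intro Bochner_Integration.integrable_cong) (auto simp: space_restrict_space)
  ultimately have uL2: "u \<in> L2 \<Omega>" by (simp add: L2_def)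
  have deriv: "\<exists>g. conical (Suc 0) S (\<nu> - real (length bs)) g \<and> weak_deriv \<Omega> bs u g \<and> g \<in> L2 \<Omega>"
    if bs: "set bs \<subseteq> Basis" "length bs \<le> n" for bs
  proof -
    obtain g where g: "conical (Suc 0) S (\<nu> - real (length bs)) g" "weak_deriv \<Omega> bs f g"
      using conical_weak_deriv[OF \<Omega> bs(1) f] by blast
    have "real (length bs) \<le> real n" using bs(2) by simp
    then have "-1 < \<nu> - real (length bs)" using s(2) sn fs by linarith
    then have "g \<in> L2 \<Omega>" by (rule conical_L2[OF dim \<Omega>b \<Omega>(2) S g(1)])
    then show ?thesis using g cong by blast
  qed
  have "u \<in> sobolev \<Omega> n" using uL2 deriv unfolding sobolev_def by blast
  moreover have "\<exists>g\<in>L2 \<Omega>. weak_deriv \<Omega> bs u g \<and> slobodeckij_energy d \<Omega> (frac s) g < \<infinity>"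
    if bs: "set bs \<subseteq> Basis" "length bs = n" and fr: "frac s \<noteq> 0" for bs
  proof -
    obtain g where g: "conical (Suc 0) S (\<nu> - real n) g" "weak_deriv \<Omega> bs u g" "g \<in> L2 \<Omega>"
      using deriv[of bs] bs by auto
    \<comment> \<open>With this order \<open>b\<close>, the condition \<open>frac s < b + 1\<close>
      follows from \<open>s < \<nu> + 1\<close> if \<open>b = \<nu> - n\<close> and from
      \<open>frac s < 1\<close> if \<open>b = 0\<close>.\<close>
    have "conical (Suc 0) S (min (\<nu> - real n) 0) g"
      using conical_mono[OF S(1) _ g(1), of "min (\<nu> - real n) 0"] by simp
    then have "slobodeckij_energy d \<Omega> (frac s) g < \<infinity>"
      by (rule slobodeckij_energy_conical[OF dim \<Omega>b \<Omega>(2) S _ _ _ _ c v d pair])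
         (use fr fs s sn in auto)
    then show ?thesis using g by blast
  qed
  ultimately show ?thesis by (simp add: sobolev_slobodeckij_def n_def)
qed

section \<open>The inner distance\<close>

text \<open>Being joined by a chain of segments in \<Omega> is an equivalence relation with open
  classes, because balls are convex; connectedness leaves a single class, so the infimum is over a
  nonempty set. The infimum need not be attained, but it is positive for distinct points, so some
  path is shorter than twice its value.\<close>

lemma inner_dist_poly_path:
  assumes \<Omega>: "open \<Omega>" "connected \<Omega>" and xy: "x \<in> \<Omega>" "y \<in> \<Omega>" "x \<noteq> y"
  shows "dist x y \<le> inner_dist \<Omega> x y" "poly_path \<Omega> x y (2 * inner_dist \<Omega> x y)"
proof -
  define P where "P = {\<Sum>i<n. dist (p i) (p (Suc i)) | p n.
     p 0 = x \<and> p n = y \<and> (\<forall>i<n. closed_segment (p i) (p (Suc i)) \<subseteq> \<Omega>)}"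
  define R where "R = (\<lambda>a b. closed_segment a b \<subseteq> \<Omega>)"
  have "R\<^sup>*\<^sup>* x y"
  proof (rule connected_equivalence_relation[OF \<Omega>(2) xy(1,2)])
    have "symp R" by (auto simp: R_def symp_def closed_segment_commute)
    then show "R\<^sup>*\<^sup>* b a" if "R\<^sup>*\<^sup>* a b" for a b
      using that by (metis symp_rtranclp sympD)
    show "\<exists>T. openin (top_of_set \<Omega>) T \<and> a \<in> T \<and> (\<forall>b\<in>T. R\<^sup>*\<^sup>* a b)" if a: "a \<in> \<Omega>" for a
    proof -
      obtain e where e: "e > 0" "ball a e \<subseteq> \<Omega>" using \<Omega>(1) a by (auto simp: open_contains_ball)
      have "R a b" if "b \<in> ball a e" for b
        using closed_segment_subset[of a "ball a e" b] that e by (auto simp: R_def)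
      then have "\<forall>b\<in>ball a e. R\<^sup>*\<^sup>* a b" by blast
      then show ?thesis using e \<Omega>(1) by (intro exI[of _ "ball a e"]) (auto simp: openin_open_eq)
    qed
  qed auto
  then obtain n p where "p 0 = x" "p n = y" "\<forall>i<n. R (p i) (p (Suc i))"
    unfolding rtranclp_power relpowp_fun_conv by blast
  then have ne: "P \<noteq> {}" unfolding P_def R_def by blast
  have lb: "dist x y \<le> l" if "l \<in> P" for l
  proof -
    obtain p n where p: "l = (\<Sum>i<n. dist (p i) (p (Suc i)))" "p 0 = x" "p n = y"
      using \<open>l \<in> P\<close> unfolding P_def by blast
    have "dist (p 0) (p k) \<le> (\<Sum>i<k. dist (p i) (p (Suc i)))" for k
    proof (induction k)
      case (Suc k)
      then show ?case using dist_triangle[of "p 0" "p (Suc k)" "p k"] by simp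
    qed simp
    then show ?thesis using p by metis
  qed
  have I: "inner_dist \<Omega> x y = Inf P" by (simp add: inner_dist_def P_def)
  show le: "dist x y \<le> inner_dist \<Omega> x y"
    unfolding I using ne lb by (rule cInf_greatest)
  moreover have "0 < dist x y" using xy by simp
  ultimately have "Inf P < 2 * inner_dist \<Omega> x y" using I by linarith
  from cInf_lessD[OF ne this] obtain l where "l \<in> P" "l < 2 * inner_dist \<Omega> x y" by blast
  then show "poly_path \<Omega> x y (2 * inner_dist \<Omega> x y)"
    unfolding P_def poly_path_def by (smt (verit) mem_Collect_eq)
qed

lemma dist_le_inner_dist:
  assumes "open \<Omega>" "connected \<Omega>" "x \<in> \<Omega>" "y \<in> \<Omega>"
  shows "dist x y \<le> inner_dist \<Omega> x y"
proof (cases "x = y")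
  case True
  \<comment> \<open>A path without segments shows that the infimum is over a nonempty set also for
    \<open>x = y\<close>.\<close>
  have "(0::real) \<in> {\<Sum>i<n. dist (p i) (p (Suc i)) | p n.
     p 0 = x \<and> p n = y \<and> (\<forall>i<n. closed_segment (p i) (p (Suc i)) \<subseteq> \<Omega>)}"
    using True by (intro CollectI exI[of _ "\<lambda>_. x"] exI[of _ "0::nat"]) auto
  then have "0 \<le> inner_dist \<Omega> x y"
    unfolding inner_dist_def by (intro cInf_greatest) (auto intro: sum_nonneg)
  then show ?thesis using True by simp
qed (use inner_dist_poly_path assms in blast)

section \<open>The eigenfunctions of the sector\<close>

definition cplx :: "real ^ 2 \<Rightarrow> complex" where
  "cplx x = Complex (x $ 1) (x $ 2)"

lemma linear_cplx: "linear cplx"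
  by (intro linearI) (auto simp: cplx_def complex_eq_iff)

lemma norm_cplx [simp]: "norm (cplx x) = norm x"
  by (simp add: cplx_def cmod_def norm_vec_def L2_set_def sum_2)

lemma cplx_diff: "cplx (x - y) = cplx x - cplx y"
  by (simp add: cplx_def complex_eq_iff)

lemma cplx_eq_0 [simp]: "cplx x = 0 \<longleftrightarrow> x = 0"
  using norm_cplx[of x] by (metis norm_eq_zero)

lemma cplx_polar: "cplx (polar r \<phi>) = of_real r * cis \<phi>"
  by (simp add: cplx_def polar_def complex_eq_iff)

lemma norm_polar: "norm (polar r \<phi>) = \<bar>r\<bar>"
  unfolding norm_cplx[symmetric] cplx_polar by (simp add: norm_mult)

lemma cplx_inj: "cplx x = cplx y \<Longrightarrow> x = y"
  by (simp add: cplx_def vec_eq_iff forall_2)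

lemma continuous_on_cplx [continuous_intros]:
  "continuous_on A f \<Longrightarrow> continuous_on A (\<lambda>x. cplx (f x))"
  using linear_continuous_on[OF linear_linear[THEN iffD2, OF linear_cplx], of UNIV]
  by (rule continuous_on_compose2) auto

text \<open>\<open>F a\<close> stands for a branch of the power of exponent \<open>a\<close>. A
  partial derivative of \<open>Re (c * F a z)\<close> has the same form with exponent
  \<open>a - 1\<close> and coefficient \<open>c * a * cplx b\<close>, so the induction runs over
  complex \<open>c\<close>. The set \<open>A\<close> of exponents admits both slit branches with
  real exponents and single-valued integer powers.\<close>

lemma conical_Re_power:
  fixes F :: "real \<Rightarrow> complex \<Rightarrow> complex"
  assumes A: "\<And>a. a \<in> A \<Longrightarrow> a - 1 \<in> A"
    and F: "\<And>a x. a \<in> A \<Longrightarrow> x \<in> S \<Longrightarrow>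
      (F a has_field_derivative of_real a * F (a - 1) (cplx x)) (at (cplx x))"
    and nF: "\<And>a x. a \<in> A \<Longrightarrow> x \<in> S \<Longrightarrow> norm (F a (cplx x)) \<le> norm x powr a"
    and a: "a \<in> A"
  shows "conical n S a (\<lambda>x. Re (c * F a (cplx x)))"
proof -
  have D: "((\<lambda>x. Re (c * F a (cplx x))) has_derivative
      (\<lambda>h. \<Sum>b\<in>Basis. (h \<bullet> b) * Re ((c * of_real a * cplx b) * F (a - 1) (cplx x)))) (at x)"
    if "a \<in> A" "x \<in> S" for a c x
  proof -
    have "(cplx has_derivative cplx) (at x)"
      by (simp add: linear_cplx linear_imp_has_derivative)
    from has_derivative_compose[OF this F[OF that, unfolded has_field_derivative_def]]
    have "((\<lambda>x. F a (cplx x)) has_derivative (\<lambda>h. of_real a * F (a - 1) (cplx x) * cplx h)) (at x)" .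
    then have "((\<lambda>x. Re (c * F a (cplx x))) has_derivative
      (\<lambda>h. Re (c * (of_real a * F (a - 1) (cplx x) * cplx h)))) (at x)"
      by (auto intro!: derivative_eq_intros)
    moreover have "Re (c * (of_real a * F (a - 1) (cplx x) * cplx h)) =
      (\<Sum>b\<in>Basis. (h \<bullet> b) * Re ((c * of_real a * cplx b) * F (a - 1) (cplx x)))" for h
    proof -
      have "cplx h = cplx (\<Sum>b\<in>Basis. (h \<bullet> b) *\<^sub>R b)" by (simp add: euclidean_representation)
      also have "\<dots> = (\<Sum>b\<in>Basis. (h \<bullet> b) *\<^sub>R cplx b)"
        by (simp add: linear_sum[OF linear_cplx] linear_scale[OF linear_cplx])
      finally have "c * (of_real a * F (a - 1) (cplx x) * cplx h) =
        (\<Sum>b\<in>Basis. (h \<bullet> b) *\<^sub>R ((c * of_real a * cplx b) * F (a - 1) (cplx x)))"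
        by (simp add: sum_distrib_left mult_ac scaleR_conv_of_real)
      then show ?thesis by simp
    qed
    ultimately show ?thesis by simp
  qed
  have B: "\<exists>C\<ge>0. \<forall>x\<in>S. \<bar>Re (c * F a (cplx x))\<bar> \<le> C * norm x powr a" if "a \<in> A" for a c
  proof (intro exI[of _ "norm c"] conjI ballI)
    fix x assume "x \<in> S"
    have "\<bar>Re (c * F a (cplx x))\<bar> \<le> norm c * norm (F a (cplx x))"
      using abs_Re_le_cmod[of "c * F a (cplx x)"] by (simp add: norm_mult)
    also have "\<dots> \<le> norm c * norm x powr a"
      using nF[OF that \<open>x \<in> S\<close>] by (intro mult_left_mono) auto
    finally show "\<bar>Re (c * F a (cplx x))\<bar> \<le> norm c * norm x powr a" .
  qed auto
  show ?thesis using a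
  proof (induction n arbitrary: a c)
    case 0
    have "continuous_on S (\<lambda>x. Re (c * F a (cplx x)))"
      using D[OF 0] by (intro continuous_at_imp_continuous_on) (auto intro: has_derivative_continuous)
    then show ?case using B[OF 0] by simp
  next
    case (Suc n)
    show ?case
      unfolding conical.simps
    proof (intro conjI B[OF Suc.prems] ballI
        exI[of _ "\<lambda>b x. Re ((c * of_real a * cplx b) * F (a - 1) (cplx x))"])
      show "((\<lambda>x. Re (c * F a (cplx x))) has_derivative
        (\<lambda>h. \<Sum>b\<in>Basis. (h \<bullet> b) * Re ((c * of_real a * cplx b) * F (a - 1) (cplx x)))) (at x)"
        if "x \<in> S" for x using D[OF Suc.prems that] .
      show "conical n S (a - 1) (\<lambda>x. Re ((c * of_real a * cplx b) * F (a - 1) (cplx x)))" for b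
        by (rule Suc.IH[OF A[OF Suc.prems]])
    qed
  qed
qed

section \<open>The radial factor as an entire power series in the squared norm\<close>

lemma conical_component:
  assumes "0 \<notin> S" "b \<in> Basis"
  shows "conical n S 1 (\<lambda>x. x \<bullet> b)"
proof -
  have B: "\<exists>C\<ge>0. \<forall>x\<in>S. \<bar>x \<bullet> b\<bar> \<le> C * norm x powr 1"
    using Basis_le_norm[OF assms(2)] by (intro exI[of _ 1]) auto
  show ?thesis
  proof (cases n)
    case 0
    then show ?thesis using B by (auto intro!: continuous_intros)
  next
    case (Suc m)
    have "((\<lambda>x. x \<bullet> b) has_derivative (\<lambda>h. \<Sum>b'\<in>Basis. (h \<bullet> b') * (if b' = b then 1 else 0))) (at x)" for x
    proof -
      have "(\<Sum>b'\<in>Basis. (h \<bullet> b') * (if b' = b then 1 else 0)) = h \<bullet> b" for h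
        using assms(2) sum.delta'[of Basis b "\<lambda>b'. h \<bullet> b'"] by (simp add: if_distrib cong: if_cong)
      then show ?thesis by (auto intro!: derivative_eq_intros)
    qed
    then show ?thesis
      unfolding Suc conical.simps using B conical_const[OF assms(1)]
      by (intro conjI exI[of _ "\<lambda>b' _. if b' = b then 1 else 0"]) auto
  qed
qed

text \<open>By the chain rule, a partial derivative is twice a coordinate times the series with
  coefficients \<open>diffs c\<close>, which again converges everywhere. This product has order 1,
  more than the order -1 required. Doubling is written as a sum so that \<open>conical_add\<close>
  applies.\<close>

lemma conical_power_series:
  fixes c :: "nat \<Rightarrow> real" and S :: "'a::euclidean_space set"
  assumes S: "S \<subseteq> ball 0 1" "0 \<notin> S" and c: "\<And>t. summable (\<lambda>j. c j * t ^ j)"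
  shows "conical n S 0 (\<lambda>x. \<Sum>j. c j * ((norm x)\<^sup>2) ^ j)"
  using c
proof (induction n arbitrary: c)
  have B: "\<exists>C\<ge>0. \<forall>x\<in>S. \<bar>\<Sum>j. c j * ((norm x)\<^sup>2) ^ j\<bar> \<le> C * norm x powr 0"
    and C: "continuous_on S (\<lambda>x. \<Sum>j. c j * ((norm x)\<^sup>2) ^ j)"
    if c: "\<And>t. summable (\<lambda>j. c j * t ^ j)" for c :: "nat \<Rightarrow> real"
  proof -
    have cont: "continuous_on A (\<lambda>t. \<Sum>j. c j * t ^ j)" for A
      using termdiffs_strong_converges_everywhere[OF c]
      by (intro continuous_at_imp_continuous_on) (auto intro: DERIV_isCont)
    have "bounded ((\<lambda>t. \<Sum>j. c j * t ^ j) ` {0..1})"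
      by (intro compact_imp_bounded compact_continuous_image cont) auto
    then obtain M where M: "M > 0" "\<And>t. t \<in> {0..1} \<Longrightarrow> \<bar>\<Sum>j. c j * t ^ j\<bar> \<le> M"
      unfolding bounded_pos by auto
    have "\<bar>\<Sum>j. c j * ((norm x)\<^sup>2) ^ j\<bar> \<le> M * norm x powr 0" if "x \<in> S" for x
    proof -
      have "x \<noteq> 0" "norm x \<le> 1" using that S by auto
      then show ?thesis using M(2)[of "(norm x)\<^sup>2"] by (simp add: power_le_one)
    qed
    then show "\<exists>C\<ge>0. \<forall>x\<in>S. \<bar>\<Sum>j. c j * ((norm x)\<^sup>2) ^ j\<bar> \<le> C * norm x powr 0"
      using M(1) by (intro exI[of _ M]) auto
    show "continuous_on S (\<lambda>x. \<Sum>j. c j * ((norm x)\<^sup>2) ^ j)"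
      by (rule continuous_on_compose2[OF cont[of UNIV]]) (auto intro!: continuous_intros)
  qed
  case 0
  then show ?case using B C by simp
next
  case (Suc n)
  have B: "\<exists>C\<ge>0. \<forall>x\<in>S. \<bar>\<Sum>j. c j * ((norm x)\<^sup>2) ^ j\<bar> \<le> C * norm x powr 0"
    using Suc.IH[OF Suc.prems] by (rule conical_bound)
  have sd: "summable (\<lambda>j. diffs c j * t ^ j)" for t
    using Suc.prems by (intro termdiff_converges_all) auto
  show ?case
    unfolding conical.simps
  proof (intro conjI B ballI
      exI[of _ "\<lambda>b x. (x \<bullet> b + x \<bullet> b) * (\<Sum>j. diffs c j * ((norm x)\<^sup>2) ^ j)"])
    fix x assume "x \<in> S"
    have "((\<lambda>x. (norm x)\<^sup>2) has_derivative (\<lambda>h. 2 * (x \<bullet> h))) (at x)"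
      unfolding power2_norm_eq_inner by (auto intro!: derivative_eq_intros simp: inner_commute)
    from has_derivative_compose[OF this
      termdiffs_strong_converges_everywhere[OF Suc.prems, unfolded has_field_derivative_def]]
    have "((\<lambda>x. \<Sum>j. c j * ((norm x)\<^sup>2) ^ j) has_derivative
      (\<lambda>h. (\<Sum>j. diffs c j * ((norm x)\<^sup>2) ^ j) * (2 * (x \<bullet> h)))) (at x)" .
    also have "(\<lambda>h. (\<Sum>j. diffs c j * ((norm x)\<^sup>2) ^ j) * (2 * (x \<bullet> h))) =
      (\<lambda>h. \<Sum>b\<in>Basis. (h \<bullet> b) * ((x \<bullet> b + x \<bullet> b) * (\<Sum>j. diffs c j * ((norm x)\<^sup>2) ^ j)))"
    proof
      fix h
      have "x \<bullet> h = (\<Sum>b\<in>Basis. (x \<bullet> b) * (h \<bullet> b))" by (rule euclidean_inner)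
      then show "(\<Sum>j. diffs c j * ((norm x)\<^sup>2) ^ j) * (2 * (x \<bullet> h)) =
        (\<Sum>b\<in>Basis. (h \<bullet> b) * ((x \<bullet> b + x \<bullet> b) * (\<Sum>j. diffs c j * ((norm x)\<^sup>2) ^ j)))"
        by (simp add: sum_distrib_left sum_distrib_right mult_ac)
    qed
    finally show "((\<lambda>x. \<Sum>j. c j * ((norm x)\<^sup>2) ^ j) has_derivative
      (\<lambda>h. \<Sum>b\<in>Basis. (h \<bullet> b) * ((x \<bullet> b + x \<bullet> b) * (\<Sum>j. diffs c j * ((norm x)\<^sup>2) ^ j)))) (at x)" .
  next
    fix b :: 'a assume "b \<in> Basis"
    then have "conical n S (1 + 0) (\<lambda>x. (x \<bullet> b + x \<bullet> b) * (\<Sum>j. diffs c j * ((norm x)\<^sup>2) ^ j))"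
      using conical_component[OF S(2)] by (intro conical_mult conical_add Suc.IH sd) auto
    then show "conical n S (0 - 1) (\<lambda>x. (x \<bullet> b + x \<bullet> b) * (\<Sum>j. diffs c j * ((norm x)\<^sup>2) ^ j))"
      by (rule conical_mono[OF S(1), rotated]) simp
  qed
qed

lemma bessel_J_power_series:
  assumes \<nu>: "0 \<le> \<nu>" and \<mu>: "0 < \<mu>"
  obtains c where "\<And>t::real. summable (\<lambda>j. c j * t ^ j)"
    "\<And>r. 0 < r \<Longrightarrow> bessel_J \<nu> (\<mu> * r) = r powr \<nu> * (\<Sum>j. c j * (r\<^sup>2) ^ j)"
proof -
  define a where "a j = (-1) ^ j / (fact j * Gamma (\<nu> + real j + 1))" for j
  define c where "c j = (\<mu> / 2) powr \<nu> * (a j * ((\<mu> / 2)\<^sup>2) ^ j)" for j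
  \<comment> \<open>Each step multiplies by \<open>\<nu> + j + 1 \<ge> 1\<close>. The series is
    therefore dominated by an exponential one.\<close>
  have G: "Gamma (\<nu> + 1) \<le> Gamma (\<nu> + real j + 1)" for j
  proof (induction j)
    case (Suc j)
    have p: "0 < \<nu> + real j + 1" using \<nu> by linarith
    have "Gamma (\<nu> + real (Suc j) + 1) = (\<nu> + real j + 1) * Gamma (\<nu> + real j + 1)"
      using Gamma_plus1[of "\<nu> + real j + 1"] p
      by (metis (no_types, opaque_lifting) add.assoc add.commute nonpos_Ints_nonpos not_le of_nat_Suc)
    also have "\<dots> \<ge> 1 * Gamma (\<nu> + real j + 1)"
      using \<nu> Gamma_real_pos[OF p] by (intro mult_right_mono) auto
    finally show ?case using Suc by simp
  qed simp
  have G0: "0 < Gamma (\<nu> + 1)" using \<nu> by (intro Gamma_real_pos) simp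
  have s: "summable (\<lambda>j. a j * t ^ j)" for t
  proof (rule summable_comparison_test'[where N = 0])
    show "summable (\<lambda>j. inverse (Gamma (\<nu> + 1)) * (inverse (fact j) * \<bar>t\<bar> ^ j))"
      by (intro summable_mult summable_exp)
    fix j :: nat
    have "norm (a j * t ^ j) = inverse (Gamma (\<nu> + real j + 1)) * (inverse (fact j) * \<bar>t\<bar> ^ j)"
      using G[of j] G0 by (simp add: a_def abs_mult power_abs divide_inverse mult_ac)
    also have "\<dots> \<le> inverse (Gamma (\<nu> + 1)) * (inverse (fact j) * \<bar>t\<bar> ^ j)"
      using G[of j] G0 by (intro mult_right_mono le_imp_inverse_le) auto
    finally show "norm (a j * t ^ j) \<le> inverse (Gamma (\<nu> + 1)) * (inverse (fact j) * \<bar>t\<bar> ^ j)" .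
  qed
  show ?thesis
  proof
    show "summable (\<lambda>j. c j * t ^ j)" for t
      using summable_mult[OF s[of "(\<mu> / 2)\<^sup>2 * t"], of "(\<mu> / 2) powr \<nu>"]
      by (simp add: c_def power_mult_distrib mult_ac)
    fix r :: real assume r: "0 < r"
    \<comment> \<open>For \<open>r > 0\<close> and \<open>\<nu> = 0\<close> both powers on the right
      are 1, so the case distinction in \<open>bessel_J\<close> disappears.\<close>
    have "(if \<nu> = 0 then 1 else (\<mu> * r / 2) powr \<nu>) = r powr \<nu> * (\<mu> / 2) powr \<nu>"
      using r \<mu> by (auto simp: powr_mult[symmetric] mult_ac)
    then have "bessel_J \<nu> (\<mu> * r) = (\<Sum>j. r powr \<nu> * (c j * (r\<^sup>2) ^ j))"
      unfolding bessel_J_def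
      by (intro suminf_cong) (simp add: a_def c_def power_mult power_mult_distrib power_divide)
    also have "\<dots> = r powr \<nu> * (\<Sum>j. c j * (r\<^sup>2) ^ j)"
      using summable_mult[OF s[of "(\<mu> / 2)\<^sup>2 * r\<^sup>2"], of "(\<mu> / 2) powr \<nu>"]
      by (intro suminf_mult) (simp add: c_def power_mult_distrib mult_ac)
    finally show "bessel_J \<nu> (\<mu> * r) = r powr \<nu> * (\<Sum>j. c j * (r\<^sup>2) ^ j)" .
  qed
qed

text \<open>After rotation by \<open>- \<omega> / 2\<close> the sector is symmetric about the
  positive real axis. Since \<open>cos\<close> decreases on [0, pi] and
  \<open>\<omega> / 2 \<le> pi\<close>, the angular condition becomes a comparison of cosines, and
  its strictness excludes the origin. Openness is immediate in this form.\<close>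

lemma sector_eq:
  assumes "0 < \<omega>" "\<omega> \<le> 2 * pi"
  shows "sector \<omega> = {x. norm x < 1 \<and> norm x * cos (\<omega> / 2) < Re (cplx x * cis (- (\<omega> / 2)))}"
proof (intro set_eqI iffI)
  fix x assume "x \<in> sector \<omega>"
  then obtain r \<phi> where x: "x = polar r \<phi>" "0 < r" "r < 1" "0 < \<phi>" "\<phi> < \<omega>"
    unfolding sector_def by blast
  have "cos (\<omega> / 2) < cos \<bar>\<phi> - \<omega> / 2\<bar>"
    using x assms by (intro cos_monotone_0_pi) (auto simp: abs_if)
  then have "cos (\<omega> / 2) < cos (\<phi> - \<omega> / 2)" by simp
  moreover have "Re (cplx x * cis (- (\<omega> / 2))) = r * cos (\<phi> - \<omega> / 2)"
    unfolding x(1) cplx_polar mult.assoc cis_mult by simp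
  ultimately show "x \<in> {x. norm x < 1 \<and> norm x * cos (\<omega> / 2) < Re (cplx x * cis (- (\<omega> / 2)))}"
    using x by (simp add: norm_polar del: times_complex.sel)
next
  fix x assume "x \<in> {x. norm x < 1 \<and> norm x * cos (\<omega> / 2) < Re (cplx x * cis (- (\<omega> / 2)))}"
  then have x: "norm x < 1" "norm x * cos (\<omega> / 2) < Re (cplx x * cis (- (\<omega> / 2)))" by auto
  define z where "z = cplx x * cis (- (\<omega> / 2))"
  have nz: "norm z = norm x" by (simp add: z_def norm_mult)
  have z0: "z \<noteq> 0" using x(2) nz by (auto simp: z_def[symmetric])
  define \<psi> where "\<psi> = Arg z"
  have z: "z = of_real (norm x) * cis \<psi>" using rcis_cmod_Arg[of z] by (simp add: nz \<psi>_def rcis_def)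
  have \<psi>: "-pi < \<psi>" "\<psi> \<le> pi" using Arg_bounded[of z] by (auto simp: \<psi>_def)
  have "norm x * cos (\<omega> / 2) < norm x * cos \<psi>"
    using x(2) unfolding z_def[symmetric] by (subst (asm) z) simp
  then have "cos (\<omega> / 2) < cos \<psi>" using mult_less_cancel_left[of "norm x"] by auto
  then have "cos (\<omega> / 2) < cos \<bar>\<psi>\<bar>" by simp
  then have "\<bar>\<psi>\<bar> < \<omega> / 2"
    using \<psi> assms cos_monotone_0_pi_le[of "\<omega> / 2" "\<bar>\<psi>\<bar>"] by (force simp: not_le[symmetric])
  moreover have "cplx x = cplx (polar (norm x) (\<psi> + \<omega> / 2))"
  proof -
    have "cplx x = z * cis (\<omega> / 2)" by (simp add: z_def mult.assoc cis_mult)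
    then show ?thesis by (simp add: z cplx_polar mult.assoc cis_mult)
  qed
  ultimately show "x \<in> sector \<omega>"
    unfolding sector_def using x(1) z0 nz cplx_inj
    by (intro CollectI exI[of _ "norm x"] exI[of _ "\<psi> + \<omega> / 2"]) auto
qed

lemma open_sector:
  assumes "0 < \<omega>" "\<omega> \<le> 2 * pi"
  shows "open (sector \<omega>)"
  unfolding sector_eq[OF assms] by (intro open_Collect_conj open_Collect_less continuous_intros)

lemma connected_sector: "connected (sector \<omega>)"
proof -
  have "continuous_on A (\<lambda>(r, \<phi>). polar r \<phi>)" for A
  proof -
    have "(\<lambda>(r, \<phi>). polar r \<phi>) = (\<lambda>p. \<chi> i. if i = 1 then fst p * cos (snd p) else fst p * sin (snd p))"
      by (auto simp: polar_def vec_eq_iff forall_2 fun_eq_iff)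
    moreover have "continuous_on A (\<lambda>p. if i = 1 then fst p * cos (snd p) else fst p * sin (snd p))" for i :: 2
      by (cases "i = 1") (auto intro!: continuous_intros)
    ultimately show ?thesis by (simp add: continuous_on_vec_lambda)
  qed
  then have "connected ((\<lambda>(r, \<phi>). polar r \<phi>) ` ({0<..<1} \<times> {0<..<\<omega>}))"
    by (intro connected_continuous_image connected_Times) auto
  also have "(\<lambda>(r, \<phi>). polar r \<phi>) ` ({0<..<1} \<times> {0<..<\<omega>}) = sector \<omega>"
    by (auto simp: sector_def image_iff Bex_def) blast
  finally show ?thesis .
qed

text \<open>The eigenfunction is written as the real part of a power branch times the radial series.
  \<open>S\<close>, \<open>F\<close>, \<open>A\<close> and \<open>d\<close> are left open so that
  slit branches and integer powers share the argument. The second unit vector is the normal because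
  for \<open>\<omega> = 2 * pi\<close> the slit lies on the first axis.\<close>

lemma sector_regularity:
  fixes F :: "real \<Rightarrow> complex \<Rightarrow> complex"
  assumes \<omega>: "0 < \<omega>" "\<omega> \<le> 2 * pi" and \<nu>: "0 \<le> \<nu>" and \<mu>: "0 < \<mu>"
    and u: "\<And>r \<phi>. \<lbrakk>0 < r; r < 1; 0 < \<phi>; \<phi> < \<omega>\<rbrakk> \<Longrightarrow> u (polar r \<phi>) = bessel_J \<nu> (\<mu> * r) * cos (\<nu> * \<phi>)"
    and s: "0 \<le> s" "s < \<nu> + 1"
    and S: "sector \<omega> \<subseteq> S" "S \<subseteq> ball 0 1" "0 \<notin> S"
    and A: "\<And>a. a \<in> A \<Longrightarrow> a - 1 \<in> A" "\<nu> \<in> A"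
    and F: "\<And>a x. a \<in> A \<Longrightarrow> x \<in> S \<Longrightarrow>
      (F a has_field_derivative of_real a * F (a - 1) (cplx x)) (at (cplx x))"
    and nF: "\<And>a x. a \<in> A \<Longrightarrow> x \<in> S \<Longrightarrow> norm (F a (cplx x)) \<le> norm x powr a"
    and F\<nu>: "\<And>r \<phi>. \<lbrakk>0 < r; 0 < \<phi>; \<phi> < \<omega>\<rbrakk> \<Longrightarrow>
      F \<nu> (of_real r * cis \<phi>) = of_real (r powr \<nu>) * cis (\<nu> * \<phi>)"
    and c: "0 < c"
    and d: "\<And>x y. x \<in> sector \<omega> \<Longrightarrow> y \<in> sector \<omega> \<Longrightarrow> dist x y \<le> d x y"
    and pair: "\<And>x y. x \<in> sector \<omega> \<Longrightarrow> y \<in> sector \<omega> \<Longrightarrow> x \<noteq> y \<Longrightarrow>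
      c * max (norm x) (norm y) \<le> d x y \<or> poly_path S x y (2 * d x y) \<or>
      frac s < 1/2 \<and> \<bar>x $ 2\<bar> \<le> d x y \<and> \<bar>y $ 2\<bar> \<le> d x y"
  shows "u \<in> sobolev_slobodeckij d (sector \<omega>) s"
proof -
  obtain a where a: "\<And>t::real. summable (\<lambda>j. a j * t ^ j)"
    "\<And>r. 0 < r \<Longrightarrow> bessel_J \<nu> (\<mu> * r) = r powr \<nu> * (\<Sum>j. a j * (r\<^sup>2) ^ j)"
    using bessel_J_power_series[OF \<nu> \<mu>] by blast
  define f where "f x = Re (1 * F \<nu> (cplx x)) * (\<Sum>j. a j * ((norm x)\<^sup>2) ^ j)" for x
  show ?thesis
  proof (rule sobolev_slobodeckij_conical[OF _ open_sector[OF \<omega>] S _ _ s c, where f = f and v = "axis 2 1"])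
    show "conical N S \<nu> f" for N
      using conical_mult[OF conical_Re_power[OF A(1) F nF A(2)] conical_power_series[OF S(2,3) a(1)], of N 1]
      by (simp add: f_def[abs_def])
    show "u x = f x" if x_in: "x \<in> sector \<omega>" for x
    proof -
      obtain r \<phi> where x: "x = polar r \<phi>" "0 < r" "r < 1" "0 < \<phi>" "\<phi> < \<omega>"
        using x_in unfolding sector_def by blast
      then show ?thesis by (simp add: u f_def cplx_polar norm_polar F\<nu> a(2))
    qed
    show "axis 2 1 \<in> (Basis :: (real ^ 2) set)" by (simp add: axis_in_Basis_iff)
    show "c * max (norm x) (norm y) \<le> d x y \<or> poly_path S x y (2 * d x y) \<or>
      frac s < 1/2 \<and> \<bar>x \<bullet> axis 2 1\<bar> \<le> d x y \<and> \<bar>y \<bullet> axis 2 1\<bar> \<le> d x y"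
      if "x \<in> sector \<omega>" "y \<in> sector \<omega>" "x \<noteq> y" for x y
      using pair[OF that] by (simp add: inner_axis)
  qed (use d in auto)
qed

text \<open>The branch of \<open>z \<mapsto> z powr a\<close> on the plane slit along the ray of angle \<open>\<alpha> + pi\<close>.\<close>

definition slit_power :: "real \<Rightarrow> real \<Rightarrow> complex \<Rightarrow> complex" where
  "slit_power \<alpha> a z = exp (of_real a * (Ln (z * cis (- \<alpha>)) + \<i> * of_real \<alpha>))"

lemma exp_Ln_rotate:
  assumes "z \<noteq> 0"
  shows "exp (Ln (z * cis (- \<alpha>)) + \<i> * of_real \<alpha>) = z"
proof -
  have "exp (Ln (z * cis (- \<alpha>)) + \<i> * of_real \<alpha>) = z * cis (- \<alpha>) * cis \<alpha>"
    using assms by (simp add: exp_add cis_conv_exp)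
  then show ?thesis by (simp add: mult.assoc cis_mult)
qed

text \<open>The rotated logarithm plus its correction is a logarithm of \<open>z\<close>, so
  lowering the exponent by 1 is division by \<open>z\<close>.\<close>

lemma slit_power_deriv:
  assumes "z * cis (- \<alpha>) \<notin> \<real>\<^sub>\<le>\<^sub>0"
  shows "(slit_power \<alpha> a has_field_derivative of_real a * slit_power \<alpha> (a - 1) z) (at z)"
proof -
  have z: "z \<noteq> 0" using assms by auto
  let ?L = "Ln (z * cis (- \<alpha>)) + \<i> * of_real \<alpha>"
  have "(slit_power \<alpha> a has_field_derivative
      exp (of_real a * ?L) * (of_real a * (inverse (z * cis (- \<alpha>)) * cis (- \<alpha>)))) (at z)"
    unfolding slit_power_def[abs_def] using assms
    by (auto intro!: derivative_eq_intros simp: divide_inverse)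
  also have "inverse (z * cis (- \<alpha>)) * cis (- \<alpha>) = inverse z"
    by (simp add: field_simps)
  also have "exp (of_real a * ?L) * (of_real a * inverse z) = of_real a * slit_power \<alpha> (a - 1) z"
  proof -
    have "slit_power \<alpha> (a - 1) z = exp (of_real a * ?L - ?L)"
      by (simp add: slit_power_def left_diff_distrib)
    also have "\<dots> = exp (of_real a * ?L) / z"
      unfolding exp_diff exp_Ln_rotate[OF z] ..
    finally show ?thesis by (simp add: divide_inverse)
  qed
  finally show ?thesis .
qed

lemma norm_slit_power:
  assumes "z \<noteq> 0"
  shows "norm (slit_power \<alpha> a z) = norm z powr a"
  using assms by (simp add: slit_power_def powr_def norm_mult)

text \<open>The hypothesis puts \<open>\<phi> - \<alpha>\<close> in the principal range of
  \<open>Ln\<close>. With \<open>\<alpha> = \<omega> / 2\<close> it holds for all angles of the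
  sector, even for \<open>\<omega> = 2 * pi\<close>.\<close>

lemma slit_power_polar:
  assumes "0 < r" "\<bar>\<phi> - \<alpha>\<bar> < pi"
  shows "slit_power \<alpha> a (of_real r * cis \<phi>) = of_real (r powr a) * cis (a * \<phi>)"
proof -
  have "Ln (of_real r * cis \<phi> * cis (- \<alpha>)) = of_real (ln r) + \<i> * of_real (\<phi> - \<alpha>)"
  proof (rule Ln_unique)
    show "exp (of_real (ln r) + \<i> * of_real (\<phi> - \<alpha>)) = of_real r * cis \<phi> * cis (- \<alpha>)"
      using assms(1) unfolding exp_add cis_conv_exp[symmetric] exp_of_real mult.assoc cis_mult by simp
  qed (use assms in auto)
  then have "slit_power \<alpha> a (of_real r * cis \<phi>) = exp (of_real a * (of_real (ln r) + \<i> * of_real \<phi>))"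
    by (simp add: slit_power_def algebra_simps)
  also have "\<dots> = exp (of_real (a * ln r)) * exp (\<i> * of_real (a * \<phi>))"
    by (simp add: algebra_simps flip: exp_add)
  also have "\<dots> = of_real (r powr a) * cis (a * \<phi>)"
    using assms(1) unfolding exp_of_real cis_conv_exp by (simp add: powr_def)
  finally show ?thesis .
qed

section \<open>Segments that leave the domain of a branch\<close>

lemma segment_meets:
  fixes x y :: "'a::euclidean_space"
  assumes "\<not> closed_segment x y \<subseteq> S" "closed_segment x y \<subseteq> B"
  obtains z where "z \<in> B" "z \<notin> S" "dist x z \<le> dist x y" "dist y z \<le> dist x y"
proof -
  obtain z where z: "z \<in> closed_segment x y" "z \<notin> S" using assms(1) by blast
  then show ?thesis
    using that[of z] assms(2) dist_in_closed_segment[OF z(1)] by (auto simp: dist_commute)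
qed

lemma dist_sector_slit:
  assumes \<omega>: "0 < \<omega>" "\<omega> < 2 * pi"
  obtains c where "0 < c" "\<And>x z. x \<in> sector \<omega> \<Longrightarrow> cplx z * cis (- (\<omega> / 2)) \<in> \<real>\<^sub>\<le>\<^sub>0 \<Longrightarrow> c * norm x \<le> dist x z"
proof -
  \<comment> \<open>Positive because \<open>\<omega> / 2 < pi\<close>; the cap at 1 keeps
    \<open>1 - \<delta>\<close> nonnegative, as the estimate of the mixed term requires.\<close>
  define \<delta> where "\<delta> = min 1 (1 + cos (\<omega> / 2))"
  have "cos pi < cos (\<omega> / 2)" using \<omega> by (intro cos_monotone_0_pi) auto
  then have \<delta>: "0 < \<delta>" "\<delta> \<le> 1" "\<delta> \<le> 1 + cos (\<omega> / 2)" by (auto simp: \<delta>_def)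
  show ?thesis
  proof (rule that[of "sqrt \<delta>"])
    fix x z assume x: "x \<in> sector \<omega>" and z: "cplx z * cis (- (\<omega> / 2)) \<in> \<real>\<^sub>\<le>\<^sub>0"
    obtain t where t: "cplx z * cis (- (\<omega> / 2)) = of_real t" "t \<le> 0"
      using z by (auto elim: nonpos_Reals_cases)
    define w where "w = cplx x * cis (- (\<omega> / 2))"
    have w: "norm w = norm x" "norm x * cos (\<omega> / 2) \<le> Re w"
      using x \<omega> by (auto simp: w_def norm_mult sector_eq)
    have "dist x z = norm (cplx (x - z) * cis (- (\<omega> / 2)))"
      by (simp add: norm_mult dist_norm)
    also have "cplx (x - z) * cis (- (\<omega> / 2)) = w - of_real t"
      using t by (simp add: cplx_diff left_diff_distrib w_def)
    finally have "(dist x z)\<^sup>2 = (Re w - t)\<^sup>2 + (Im w)\<^sup>2" by (simp add: cmod_power2)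
    also have "\<dots> = (norm w)\<^sup>2 + t\<^sup>2 + 2 * (- t) * Re w"
      unfolding cmod_power2 by (simp add: power2_eq_square algebra_simps)
    finally have e: "(dist x z)\<^sup>2 = (norm x)\<^sup>2 + t\<^sup>2 + 2 * (- t) * Re w" using w by simp
    have "norm x * (\<delta> - 1) \<le> norm x * cos (\<omega> / 2)"
      using \<delta> by (intro mult_left_mono) auto
    \<comment> \<open>The mixed term in the law of cosines is at least
      \<open>- (1 - \<delta>)\<close> times the sum of the squares of \<open>norm x\<close> and
      \<open>t\<close>, so a fraction \<delta> of that sum survives.\<close>
    then have "- (2 * (- t) * (norm x * (1 - \<delta>))) \<le> 2 * (- t) * Re w"
      using w t mult_left_mono[of "norm x * (\<delta> - 1)" "Re w" "2 * (- t)"] by (simp add: algebra_simps)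
    moreover have "2 * (- t) * norm x * (1 - \<delta>) \<le> ((norm x)\<^sup>2 + t\<^sup>2) * (1 - \<delta>)"
      using \<delta> sum_squares_bound[of "norm x" "- t"] by (intro mult_right_mono) (auto simp: mult_ac)
    moreover have "0 \<le> \<delta> * t\<^sup>2" using \<delta> by simp
    ultimately have "\<delta> * (norm x)\<^sup>2 \<le> (dist x z)\<^sup>2"
      unfolding e by (simp add: algebra_simps)
    then have "sqrt (\<delta> * (norm x)\<^sup>2) \<le> sqrt ((dist x z)\<^sup>2)" by (rule real_sqrt_le_mono)
    then show "sqrt \<delta> * norm x \<le> dist x z" by (simp add: real_sqrt_mult)
  qed (use \<delta> in auto)
qed

section \<open>Regularity for the inner and the Euclidean distance\<close>

theorem lemma1:
  fixes \<omega> \<nu> \<mu> s :: real and k m :: nat and u :: "real ^ 2 \<Rightarrow> real"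
  assumes "0 < \<omega>" and "\<omega> \<le> 2 * pi"
    and "1 \<le> m"
    and "\<nu> = real k * (pi / \<omega>)"
    and "is_bessel_root \<nu> m \<mu>"
    and "\<And>r \<phi>. \<lbrakk>0 < r; r < 1; 0 < \<phi>; \<phi> < \<omega>\<rbrakk> \<Longrightarrow>
           u (polar r \<phi>) = bessel_J \<nu> (\<mu> * r) * cos (\<nu> * \<phi>)"
    and "0 \<le> s" and "s < \<nu> + 1"
  shows "u \<in> sobolev_slobodeckij (inner_dist (sector \<omega>)) (sector \<omega>) s \<and>
         (\<omega> < 2 * pi \<or> even k \<or> frac s < 1 / 2 \<longrightarrow>
            u \<in> sobolev_slobodeckij dist (sector \<omega>) s)"
proof -
  note \<omega> = assms(1,2) and u = assms(6) and s = assms(7,8)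
  have \<nu>: "0 \<le> \<nu>" using assms(1,4) by simp
  have \<mu>: "0 < \<mu>" using assms(5) by (simp add: is_bessel_root_def)
  let ?\<Omega> = "sector \<omega>"
  have \<Omega>1: "?\<Omega> \<subseteq> ball 0 1" using sector_eq[OF \<omega>] by auto
  have \<Omega>0: "0 \<notin> ?\<Omega>" using \<omega> by (auto simp: sector_eq cplx_def)
  \<comment> \<open>The unit disc without the ray opposite to the bisector of the sector: on it
    \<open>slit_power (\<omega> / 2)\<close> is holomorphic, and segments may leave the sector
    inside it.\<close>
  define S where "S = {x \<in> ball 0 1. cplx x * cis (- (\<omega> / 2)) \<notin> \<real>\<^sub>\<le>\<^sub>0}"
  have S: "S \<subseteq> ball 0 1" "0 \<notin> S" by (auto simp: S_def cplx_def complex_nonpos_Reals_iff)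
  have \<Omega>S: "?\<Omega> \<subseteq> S"
  proof
    fix x assume x: "x \<in> ?\<Omega>"
    define w where "w = cplx x * cis (- (\<omega> / 2))"
    have "norm x * (-1) \<le> norm x * cos (\<omega> / 2)" by (intro mult_left_mono) auto
    moreover have "norm x * cos (\<omega> / 2) < Re w" using x \<omega> by (simp add: sector_eq w_def)
    moreover have "norm w = norm x" by (simp add: w_def norm_mult)
    ultimately have "- norm w < Re w" by linarith
    \<comment> \<open>A nonpositive real number has real part equal to minus its norm.\<close>
    then have "w \<notin> \<real>\<^sub>\<le>\<^sub>0" by (auto elim!: nonpos_Reals_cases)
    then show "x \<in> S" using x \<Omega>1 by (auto simp: S_def w_def)
  qed
  \<comment> \<open>All cases but that of even \<open>k\<close> on the slit disc use this branch and
    differ only in how pairs of points are compared.\<close>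
  have slit: "u \<in> sobolev_slobodeckij d ?\<Omega> s"
    if c: "0 < c" and d: "\<And>x y. x \<in> ?\<Omega> \<Longrightarrow> y \<in> ?\<Omega> \<Longrightarrow> dist x y \<le> d x y"
      and pair: "\<And>x y. x \<in> ?\<Omega> \<Longrightarrow> y \<in> ?\<Omega> \<Longrightarrow> x \<noteq> y \<Longrightarrow>
        c * max (norm x) (norm y) \<le> d x y \<or> poly_path S x y (2 * d x y) \<or>
        frac s < 1/2 \<and> \<bar>x $ 2\<bar> \<le> d x y \<and> \<bar>y $ 2\<bar> \<le> d x y" for c d
  proof (rule sector_regularity[OF \<omega> \<nu> \<mu> u s \<Omega>S S _ _ _ _ _ c d pair,
        where F = "slit_power (\<omega> / 2)" and A = UNIV])
    show "(slit_power (\<omega> / 2) a has_field_derivative of_real a * slit_power (\<omega> / 2) (a - 1) (cplx x)) (at (cplx x))"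
      if "x \<in> S" for a x using that by (intro slit_power_deriv) (simp add: S_def)
    show "norm (slit_power (\<omega> / 2) a (cplx x)) \<le> norm x powr a" if "x \<in> S" for a x
      using that S by (subst norm_slit_power) auto
    show "slit_power (\<omega> / 2) \<nu> (of_real r * cis \<phi>) = of_real (r powr \<nu>) * cis (\<nu> * \<phi>)"
      if "0 < r" "0 < \<phi>" "\<phi> < \<omega>" for r \<phi>
      using that \<omega> by (intro slit_power_polar) auto
  qed auto
  have seg: "closed_segment x y \<subseteq> ball 0 1" if "x \<in> ?\<Omega>" "y \<in> ?\<Omega>" for x y
    using that \<Omega>1 by (intro closed_segment_subset) auto
  have "u \<in> sobolev_slobodeckij (inner_dist ?\<Omega>) ?\<Omega> s"
  proof (rule slit[of 1])
    fix x y assume xy: "x \<in> ?\<Omega>" "y \<in> ?\<Omega>"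
    show "dist x y \<le> inner_dist ?\<Omega> x y"
      using xy by (intro dist_le_inner_dist open_sector connected_sector \<omega>)
    assume "x \<noteq> y"
    then have "poly_path ?\<Omega> x y (2 * inner_dist ?\<Omega> x y)"
      using xy by (intro inner_dist_poly_path open_sector connected_sector \<omega>)
    then have "poly_path S x y (2 * inner_dist ?\<Omega> x y)"
      using \<Omega>S by (rule poly_path_mono)
    then show "1 * max (norm x) (norm y) \<le> inner_dist ?\<Omega> x y \<or> poly_path S x y (2 * inner_dist ?\<Omega> x y) \<or>
        frac s < 1/2 \<and> \<bar>x $ 2\<bar> \<le> inner_dist ?\<Omega> x y \<and> \<bar>y $ 2\<bar> \<le> inner_dist ?\<Omega> x y" by blast
  qed simp
  moreover have "u \<in> sobolev_slobodeckij dist ?\<Omega> s" if lt: "\<omega> < 2 * pi"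
  proof -
    obtain c where c: "0 < c"
      "\<And>x z. x \<in> ?\<Omega> \<Longrightarrow> cplx z * cis (- (\<omega> / 2)) \<in> \<real>\<^sub>\<le>\<^sub>0 \<Longrightarrow> c * norm x \<le> dist x z"
      using dist_sector_slit[OF \<omega>(1) lt] by blast
    show ?thesis
    proof (rule slit[OF c(1)])
      fix x y assume xy: "x \<in> ?\<Omega>" "y \<in> ?\<Omega>" "x \<noteq> y"
      \<comment> \<open>A segment leaving \<open>S\<close> meets the removed ray, whose distance
        from a point of the sector is at least \<open>c\<close> times the norm of that
        point.\<close>
      have "c * max (norm x) (norm y) \<le> dist x y" if ns: "\<not> closed_segment x y \<subseteq> S"
      proof -
        obtain z where z: "z \<in> ball 0 1" "z \<notin> S" "dist x z \<le> dist x y" "dist y z \<le> dist x y"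
          using segment_meets[OF ns seg] xy by blast
        then have "cplx z * cis (- (\<omega> / 2)) \<in> \<real>\<^sub>\<le>\<^sub>0" by (auto simp: S_def)
        then have "c * norm x \<le> dist x y" "c * norm y \<le> dist x y"
          using c(2)[OF xy(1)] c(2)[OF xy(2)] z(3,4) order_trans by blast+
        then show ?thesis by (auto simp: max_def)
      qed
      then show "c * max (norm x) (norm y) \<le> dist x y \<or> poly_path S x y (2 * dist x y) \<or>
        frac s < 1/2 \<and> \<bar>x $ 2\<bar> \<le> dist x y \<and> \<bar>y $ 2\<bar> \<le> dist x y"
        using poly_path_segment[of x y S "2 * dist x y"] by auto
    qed auto
  qed
  moreover have "u \<in> sobolev_slobodeckij dist ?\<Omega> s" if full: "\<omega> = 2 * pi" "even k"
  proof -
    \<comment> \<open>For \<open>\<omega> = 2 * pi\<close>, \<open>\<nu> = k / 2\<close> is an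
      integer, so the power is single-valued and only the origin is removed. Derivatives run into
      negative exponents, hence \<open>powi\<close> and all of \<int> for \<open>A\<close>.\<close>
    obtain N where N: "\<nu> = real N" using full assms(4) by (auto elim!: evenE)
    define B where "B = ball (0 :: real ^ 2) 1 - {0}"
    show ?thesis
    proof (rule sector_regularity[OF \<omega> \<nu> \<mu> u s, where S = B and A = \<int> and c = 1
          and F = "\<lambda>a z. z powi \<lfloor>a\<rfloor>"])
      show "?\<Omega> \<subseteq> B" "B \<subseteq> ball 0 1" "0 \<notin> B" using \<Omega>1 \<Omega>0 by (auto simp: B_def)
      show "((\<lambda>z. z powi \<lfloor>a\<rfloor>) has_field_derivative of_real a * (cplx x powi \<lfloor>a - 1\<rfloor>)) (at (cplx x))"
        if "a \<in> \<int>" "x \<in> B" for a x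
        using that by (auto elim!: Ints_cases simp: B_def intro!: derivative_eq_intros)
      show "norm (cplx x powi \<lfloor>a\<rfloor>) \<le> norm x powr a" if "a \<in> \<int>" "x \<in> B" for a x
        using that by (auto elim!: Ints_cases simp: B_def norm_power_int powr_real_of_int')
      show "(of_real r * cis \<phi>) powi \<lfloor>\<nu>\<rfloor> = of_real (r powr \<nu>) * cis (\<nu> * \<phi>)"
        if "0 < r" "0 < \<phi>" "\<phi> < \<omega>" for r \<phi>
        using that by (simp add: N powr_realpow power_mult_distrib Complex.DeMoivre)
      fix x y assume xy: "x \<in> ?\<Omega>" "y \<in> ?\<Omega>" "x \<noteq> y"
      \<comment> \<open>A segment leaving \<open>B\<close> passes through the origin, and the
        distances of its ends from there are their norms.\<close>
      have "1 * max (norm x) (norm y) \<le> dist x y" if ns: "\<not> closed_segment x y \<subseteq> B"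
        using segment_meets[OF ns seg] xy by (force simp: B_def)
      then show "1 * max (norm x) (norm y) \<le> dist x y \<or> poly_path B x y (2 * dist x y) \<or>
        frac s < 1/2 \<and> \<bar>x $ 2\<bar> \<le> dist x y \<and> \<bar>y $ 2\<bar> \<le> dist x y"
        using poly_path_segment[of x y B "2 * dist x y"] by auto
    qed (auto simp: N)
  qed
  moreover have "u \<in> sobolev_slobodeckij dist ?\<Omega> s" if w: "\<omega> = 2 * pi" and fr: "frac s < 1/2"
  proof (rule slit[of 1])
    fix x y assume xy: "x \<in> ?\<Omega>" "y \<in> ?\<Omega>" "x \<noteq> y"
    have "\<bar>x $ 2\<bar> \<le> dist x y \<and> \<bar>y $ 2\<bar> \<le> dist x y" if ns: "\<not> closed_segment x y \<subseteq> S"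
    proof -
      obtain z where z: "z \<in> ball 0 1" "z \<notin> S" "dist x z \<le> dist x y" "dist y z \<le> dist x y"
        using segment_meets[OF ns seg] xy by blast
      \<comment> \<open>Here the rotation is by \<open>- pi\<close>, so the slit lies on the first
        axis; the second coordinate of a point is then bounded by its distance from
        \<open>z\<close>.\<close>
      then have "z $ 2 = 0" by (auto simp: S_def w cplx_def complex_nonpos_Reals_iff)
      then have "\<bar>x $ 2\<bar> \<le> dist x z" "\<bar>y $ 2\<bar> \<le> dist y z"
        using component_le_norm_cart[of "x - z" 2] component_le_norm_cart[of "y - z" 2]
        by (auto simp: dist_norm)
      then show ?thesis using z by linarith
    qed
    then show "1 * max (norm x) (norm y) \<le> dist x y \<or> poly_path S x y (2 * dist x y) \<or>
        frac s < 1/2 \<and> \<bar>x $ 2\<bar> \<le> dist x y \<and> \<bar>y $ 2\<bar> \<le> dist x y"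
      using poly_path_segment[of x y S "2 * dist x y"] fr by auto
  qed auto
  ultimately show ?thesis using \<omega>(2) by fastforce
qed

end
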